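(* Let $K$ be a compact triangulated homology manifold of even dimension. Then $\chi(K)=q_K\left(-\tfrac12\right)$. Moreover, $t=-1$ in odd dimensions, and $t=-1$ together with $t=-\tfrac12$ in even dimensions, are the only complex values $t$ on which $q_K(T)$ equals $\chi(K)$ for every compact triangulated homology manifold $K$ of the given dimension.
   Context: For a finite simplicial complex $K$ of dimension $n$, $f_p(K)$ denotes the number of $p$-dimensional simplices of $K$, $q_K(T)=\sum_{p=0}^{n} f_p(K)T^p$ is its face polynomial, and $\chi(K)$ is its Euler characteristic. A homology $n$-manifold is a topological space $X$ such that for every $x\in X$ the relative homology $H_*(X,X\setminus\{x\};\mathbb{Z})$ is isomorphic to $H_*(\mathbb{R}^n,\mathbb{R}^n\setminus\{0\};\mathbb{Z})$. A compact triangulated homology manifold of dimension $n$ is a finite simplicial complex $K$ whose underlying topological space $|K|$ is a homology $n$-manifold.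
   Formalization: The "only complex values" claim is stated for dimension n ≥ 1, since in dimension 0 q_K is the constant χ(K) and every t works; there K ranges over complexes with natural-number vertices, which represent all finite complexes up to isomorphism. *)

theory Defs
  imports "HOL-Homology.Homology" "HOL-Computational_Algebra.Polynomial"
begin

text \<open>Complexes are abstract: a complex is the set of the vertex sets of its (nonempty) simplices,
  so a \<open>p\<close>-dimensional simplex has \<open>p + 1\<close> elements. Unlike geometric complexes in a fixed
  type of class \<open>euclidean_space\<close>, complexes on the vertex type \<open>nat\<close> represent all finite simplicial
  complexes of all dimensions up to isomorphism.\<close>

definition finite_simplicial_complex :: "'v set set \<Rightarrow> bool" where
  "finite_simplicial_complex K \<longleftrightarrow>
     finite K \<and>
     (\<forall>s\<in>K. finite s \<and> s \<noteq> {}) \<and>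
     (\<forall>s\<in>K. \<forall>t. t \<subseteq> s \<and> t \<noteq> {} \<longrightarrow> t \<in> K)"

definition simplices :: "nat \<Rightarrow> 'v set set \<Rightarrow> 'v set set" where
  "simplices p K = {s \<in> K. card s = p + 1}"

definition face_number :: "nat \<Rightarrow> 'v set set \<Rightarrow> nat" where
  "face_number p K = card (simplices p K)"

text \<open>\<open>Sup\<close> rather than \<open>Max\<close> only to have the value 0 for the empty complex, all of whose
  face numbers vanish.\<close>

definition complex_dim :: "'v set set \<Rightarrow> nat" where
  "complex_dim K = (SUP s\<in>K. card s - 1)"

definition face_poly :: "'v set set \<Rightarrow> 'a::comm_ring_1 poly" where
  "face_poly K = (\<Sum>p\<le>complex_dim K. monom (of_nat (face_number p K)) p)"

definition euler_char :: "'v set set \<Rightarrow> int" where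
  "euler_char K = (\<Sum>p\<le>complex_dim K. (-1) ^ p * int (face_number p K))"

text \<open>The underlying space: points are given by their barycentric coordinates. For a finite complex
  only finitely many coordinates are not identically zero, so the product topology induces
  the usual topology on it.\<close>

definition realization :: "'v set set \<Rightarrow> ('v \<Rightarrow> real) topology" where
  "realization K = subtopology (powertop_real UNIV)
     {x. (\<forall>v. 0 \<le> x v) \<and> {v. x v \<noteq> 0} \<in> K \<and> (\<Sum>v | x v \<noteq> 0. x v) = 1}"

text \<open>\<open>Euclidean_space n\<close> consists of the sequences vanishing from index \<open>n\<close> on; its
  origin is the zero sequence. The homology groups are singular, with
  integer coefficients, and trivial in negative degrees.\<close>

definition homology_manifold :: "nat \<Rightarrow> 'a topology \<Rightarrow> bool" where
  "homology_manifold n X \<longleftrightarrow>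
     (\<forall>x\<in>topspace X. \<forall>p.
        relative_homology_group p X (topspace X - {x}) \<cong>
        relative_homology_group p (Euclidean_space n) (topspace (Euclidean_space n) - {\<lambda>i. 0}))"

definition compact_triangulated_homology_manifold :: "nat \<Rightarrow> 'v set set \<Rightarrow> bool" where
  "compact_triangulated_homology_manifold n K \<longleftrightarrow>
     finite_simplicial_complex K \<and> homology_manifold n (realization K)"

end

theory Submission
  imports Defs
begin

text \<open>For a point \<open>x\<close> in the interior of the simplex \<open>s\<close>, the pair \<open>(|K|, |K| - x)\<close> has the homology
  of \<open>(|K|, |L|)\<close>, where \<open>L\<close> consists of the simplices not containing \<open>s\<close>. Ranks of homology groups are
  additive on exact sequences, so its Euler characteristic is the alternating number of simplices
  containing \<open>s\<close>; on a homology \<open>n\<close>-manifold this number is \<open>(-1)^n\<close>. These local relations give a functional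
  equation of Dehn--Sommerville type under the reflection \<open>T \<mapsto> -1 - T\<close>, whose fixed point is \<open>-1/2\<close>.
  Conversely, the boundary of the cross-polytope and the join of the boundary of a triangle with
  \<open>n - 1\<close> pairs of points are \<open>n\<close>-spheres whose face polynomials differ by \<open>(1 + T) (1 + 2 T)^(n - 1)\<close>.\<close>

section \<open>Ranks of abelian groups\<close>

text \<open>Only the Euler characteristic of local homology is used, so no chain complex of
  simplices is set up: exactness, excision and the contractibility of a simplex determine the Euler
  characteristic of every polyhedron. A punctured polyhedron is not a polyhedron, hence the
  deformation to a subcomplex before anything is counted. Multiplying q by T turns the exponent of a
  simplex into its number of vertices, so that the binomial theorem applies; the reflection relates
  the products T q(T) at t and at -1 - t. At the fixed point q(-1/2) occurs on both sides: for even
  n the two terms combine to chi, for odd n they cancel and leave chi = 0. In the converse chi is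
  replaced by q(-1): a universal t gives each of the two spheres the same value as -1, and their
  difference is 0 at -1. So its roots -1 and -1/2 are the only candidates, and in odd dimensions
  -1/2 fails on the cross-polytope.\<close>

definition int_comb :: "('a, 'm) monoid_scheme \<Rightarrow> 'i set \<Rightarrow> ('i \<Rightarrow> 'a) \<Rightarrow> ('i \<Rightarrow> int) \<Rightarrow> 'a" where
  "int_comb G I x c = finprod G (\<lambda>i. x i [^]\<^bsub>G\<^esub> c i) I"

text \<open>A torsion element is dependent on its own, so independent families measure the group
  modulo torsion.\<close>

definition int_indep :: "('a, 'm) monoid_scheme \<Rightarrow> 'i set \<Rightarrow> ('i \<Rightarrow> 'a) \<Rightarrow> bool" where
  "int_indep G I x \<longleftrightarrow> (\<forall>c. int_comb G I x c = \<one>\<^bsub>G\<^esub> \<longrightarrow> (\<forall>i\<in>I. c i = 0))"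

text \<open>The families take values in a subset \<open>S\<close>, so that kernels and images are
  measured inside the ambient group. Families, unlike sets of elements, survive composition with a
  homomorphism that is not injective.\<close>

definition indep_sizes :: "('a, 'm) monoid_scheme \<Rightarrow> 'a set \<Rightarrow> nat set" where
  "indep_sizes G S = {card I |(I :: nat set) x. finite I \<and> x \<in> I \<rightarrow> S \<and> int_indep G I x}"

text \<open>\<open>Max\<close> is meaningful on finite sets only; finiteness is therefore carried
  along with every rank.\<close>

definition finite_rank :: "('a, 'm) monoid_scheme \<Rightarrow> 'a set \<Rightarrow> bool" where
  "finite_rank G S \<longleftrightarrow> finite (indep_sizes G S)"

definition group_rank :: "('a, 'm) monoid_scheme \<Rightarrow> 'a set \<Rightarrow> nat" where
  "group_rank G S = Max (indep_sizes G S)"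

lemma indep_sizesI:
  fixes I :: "nat set"
  assumes "finite I" "x \<in> I \<rightarrow> S" "int_indep G I x" "card I = k"
  shows "k \<in> indep_sizes G S"
  using assms unfolding indep_sizes_def by blast

lemma indep_sizesE:
  assumes "k \<in> indep_sizes G S"
  obtains I :: "nat set" and x where "finite I" "x \<in> I \<rightarrow> S" "int_indep G I x" "card I = k"
  using assms unfolding indep_sizes_def by blast

section \<open>Integer combinations and independence in an abelian group\<close>

context comm_group
begin

lemma int_comb_closed [simp]: "x \<in> I \<rightarrow> carrier G \<Longrightarrow> int_comb G I x c \<in> carrier G"
  unfolding int_comb_def by (intro finprod_closed) auto

lemma int_comb_empty [simp]: "int_comb G {} x c = \<one>"
  by (simp add: int_comb_def)

lemma int_comb_insert:
  assumes "finite I" "i \<notin> I" "x \<in> insert i I \<rightarrow> carrier G"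
  shows "int_comb G (insert i I) x c = x i [^] c i \<otimes> int_comb G I x c"
  unfolding int_comb_def using assms by (subst finprod_insert) auto

lemma int_comb_cong:
  assumes "\<And>i. i \<in> I \<Longrightarrow> x i = y i" "\<And>i. i \<in> I \<Longrightarrow> c i = d i" "y \<in> I \<rightarrow> carrier G"
  shows "int_comb G I x c = int_comb G I y d"
  unfolding int_comb_def using assms by (intro finprod_cong') auto

lemma int_comb_zero [simp]: "int_comb G I x (\<lambda>i. 0) = \<one>"
  by (simp add: int_comb_def)

lemma int_comb_add:
  assumes "x \<in> I \<rightarrow> carrier G"
  shows "int_comb G I x (\<lambda>i. c i + d i) = int_comb G I x c \<otimes> int_comb G I x d"
proof -
  have "int_comb G I x (\<lambda>i. c i + d i) = finprod G (\<lambda>i. x i [^] c i \<otimes> x i [^] d i) I"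
    unfolding int_comb_def using assms by (intro finprod_cong') (auto simp: int_pow_mult Pi_iff)
  then show ?thesis
    unfolding int_comb_def using assms by (simp add: Pi_iff)
qed

lemma int_comb_scale:
  assumes "finite I" "x \<in> I \<rightarrow> carrier G"
  shows "int_comb G I x (\<lambda>i. k * c i) = int_comb G I x c [^] (k::int)"
  using assms
proof (induction I)
  case (insert i I)
  then show ?case
    by (simp add: int_comb_insert int_pow_distrib int_pow_pow Pi_iff mult.commute)
qed auto

text \<open>Substitution: a relation among combinations of the \<open>x i\<close> becomes a relation
  among the \<open>x i\<close>, to which their independence applies.\<close>

lemma int_comb_comb:
  assumes "finite I" "x \<in> I \<rightarrow> carrier G" "finite J"
  shows "int_comb G J (\<lambda>j. int_comb G I x (c j)) d = int_comb G I x (\<lambda>i. \<Sum>j\<in>J. d j * c j i)"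
  using assms(3)
proof (induction J)
  case (insert j J)
  then show ?case
    using assms by (simp add: int_comb_insert int_comb_scale int_comb_add)
qed auto

lemma int_comb_Un_disjoint:
  assumes "finite I" "finite J" "I \<inter> J = {}" "x \<in> I \<rightarrow> carrier G" "x \<in> J \<rightarrow> carrier G"
  shows "int_comb G (I \<union> J) x c = int_comb G I x c \<otimes> int_comb G J x c"
  unfolding int_comb_def using assms by (intro finprod_Un_disjoint) auto

lemma int_comb_mono_neutral:
  assumes "finite I" "J \<subseteq> I" "\<And>i. i \<in> I - J \<Longrightarrow> c i = 0" "x \<in> I \<rightarrow> carrier G"
  shows "int_comb G I x c = int_comb G J x c"
  unfolding int_comb_def using assms
  by (intro finprod_mono_neutral_cong_right) (auto simp: Pi_iff)

lemma int_comb_reindex: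
  assumes "inj_on h J" "x \<in> h ` J \<rightarrow> carrier G"
  shows "int_comb G (h ` J) x c = int_comb G J (x \<circ> h) (c \<circ> h)"
  unfolding int_comb_def using assms by (subst finprod_reindex) (auto simp: o_def Pi_iff)

lemma int_indepD_inv:
  assumes "bij_betw h J I" "int_indep G I x" "x \<in> I \<rightarrow> carrier G"
  shows "int_indep G J (x \<circ> h)"
  unfolding int_indep_def
proof (intro allI impI)
  fix c assume c: "int_comb G J (x \<circ> h) c = \<one>"
  let ?c = "c \<circ> the_inv_into J h"
  have I: "I = h ` J" and inj: "inj_on h J"
    using assms(1) by (auto simp: bij_betw_def)
  have "int_comb G I x ?c = int_comb G J (x \<circ> h) (?c \<circ> h)"
    using assms(3) inj unfolding I by (intro int_comb_reindex) auto
  also have "\<dots> = int_comb G J (x \<circ> h) c"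
    using assms(3) inj unfolding I by (intro int_comb_cong) (auto simp: the_inv_into_f_f Pi_iff)
  finally have "int_comb G I x ?c = \<one>" using c by (rule trans)
  then have "\<forall>i\<in>I. ?c i = 0"
    using assms(2)[unfolded int_indep_def] by blast
  then show "\<forall>j\<in>J. c j = 0"
    unfolding I using inj by (auto simp: the_inv_into_f_f)
qed

text \<open>Lets families from a kernel and from an image be placed on disjoint intervals of
  indices.\<close>

lemma int_indep_on_index_set:
  assumes "k \<in> indep_sizes G S" "S \<subseteq> carrier G" "finite (J :: nat set)" "card J = k"
  obtains x where "x \<in> J \<rightarrow> S" "int_indep G J x"
proof -
  obtain I :: "nat set" and x where I: "finite I" "x \<in> I \<rightarrow> S" "int_indep G I x" "card I = k"
    using assms(1) by (auto simp: indep_sizes_def)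
  obtain h where h: "bij_betw h J I"
    using I assms by (metis finite_same_card_bij)
  have "int_indep G J (x \<circ> h)"
    using int_indepD_inv[OF h I(3)] I(2) assms(2) by blast
  moreover have "x \<circ> h \<in> J \<rightarrow> S"
    using I(2) h by (auto simp: bij_betw_def)
  ultimately show thesis using that by blast
qed

lemma zero_in_indep_sizes: "0 \<in> indep_sizes G S"
  by (rule indep_sizesI[of "{}"]) (auto simp: int_indep_def)

lemma int_indep_subset:
  assumes "int_indep G I x" "J \<subseteq> I" "finite I" "x \<in> I \<rightarrow> carrier G"
  shows "int_indep G J x"
  unfolding int_indep_def
proof (intro allI impI)
  fix c assume c: "int_comb G J x c = \<one>"
  let ?c = "\<lambda>i. if i \<in> J then c i else 0"
  have "int_comb G I x ?c = int_comb G J x ?c"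
    using assms by (intro int_comb_mono_neutral) auto
  also have "\<dots> = int_comb G J x c"
    using assms(2,4) by (intro int_comb_cong) (auto simp: Pi_iff)
  finally have "int_comb G I x ?c = \<one>" using c by (rule trans)
  then have *: "\<forall>i\<in>I. ?c i = 0"
    using assms(1)[unfolded int_indep_def] by blast
  show "\<forall>i\<in>J. c i = 0"
  proof
    fix i assume "i \<in> J"
    then show "c i = 0" using bspec[OF *, of i] assms(2) by (simp add: subsetD)
  qed
qed

lemma indep_sizes_downward:
  assumes "k \<in> indep_sizes G S" "S \<subseteq> carrier G" "l \<le> k"
  shows "l \<in> indep_sizes G S"
proof -
  obtain x where x: "x \<in> {..<k} \<rightarrow> S" "int_indep G {..<k} x"
    using int_indep_on_index_set[OF assms(1,2), of "{..<k}"] by auto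
  then have "int_indep G {..<l} x"
    using assms by (intro int_indep_subset[OF x(2)]) auto
  with x(1) assms(3) show ?thesis
    by (intro indep_sizesI[of "{..<l}" x]) auto
qed

text \<open>The possible sizes form an initial segment, so a single equation between sets can carry
  both finiteness and the rank.\<close>

lemma indep_sizes_eq:
  assumes "finite_rank G S" "S \<subseteq> carrier G"
  shows "indep_sizes G S = {..group_rank G S}"
proof -
  have "group_rank G S \<in> indep_sizes G S"
    unfolding group_rank_def using assms(1) zero_in_indep_sizes
    by (intro Max_in) (auto simp: finite_rank_def)
  moreover have "k \<le> group_rank G S" if "k \<in> indep_sizes G S" for k
    unfolding group_rank_def using assms(1) that by (simp add: finite_rank_def)
  ultimately show ?thesis
    using indep_sizes_downward assms(2) by auto
qed

text \<open>Eliminating one pivot at a time yields triangular, hence independent relations; this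
  replaces the exchange lemma.\<close>

lemma independent_relations:
  assumes "S \<subseteq> carrier G" "finite_rank G S" "finite (I :: nat set)" "y \<in> I \<rightarrow> S"
    "card I \<ge> group_rank G S + r"
  shows "\<exists>c :: nat \<Rightarrow> nat \<Rightarrow> int. (\<forall>j<r. int_comb G I y (c j) = \<one>) \<and>
     (\<forall>d. (\<forall>i\<in>I. (\<Sum>j<r. d j * c j i) = 0) \<longrightarrow> (\<forall>j<r. d j = 0))"
  using assms(3-)
proof (induction r arbitrary: I)
  case (Suc r)
  have yc: "y \<in> I \<rightarrow> carrier G" using Suc.prems(2) assms(1) by auto
  have "\<not> int_indep G I y"
  proof
    assume "int_indep G I y"
    then have "card I \<in> indep_sizes G S"
      using Suc.prems by (auto simp: indep_sizes_def)
    then show False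
      using Suc.prems(3) indep_sizes_eq[OF assms(2,1)] by simp
  qed
  then obtain b i where b: "int_comb G I y b = \<one>" "i \<in> I" "b i \<noteq> 0"
    by (auto simp: int_indep_def)
  have "card (I - {i}) = card I - 1" using b(2) Suc.prems(1) by simp
  then have "\<exists>c :: nat \<Rightarrow> nat \<Rightarrow> int. (\<forall>j<r. int_comb G (I - {i}) y (c j) = \<one>) \<and>
     (\<forall>d. (\<forall>l\<in>I - {i}. (\<Sum>j<r. d j * c j l) = 0) \<longrightarrow> (\<forall>j<r. d j = 0))"
    using Suc.prems by (intro Suc.IH) auto
  then obtain c :: "nat \<Rightarrow> nat \<Rightarrow> int" where c: "\<forall>j<r. int_comb G (I - {i}) y (c j) = \<one>"
    "\<And>d. (\<forall>l\<in>I - {i}. (\<Sum>j<r. d j * c j l) = 0) \<Longrightarrow> (\<forall>j<r. d j = 0)"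
    by blast
  define c' where "c' j = (if j = r then b else (\<lambda>l. if l = i then 0 else c j l))" for j
  have "int_comb G I y (c' j) = \<one>" if "j < Suc r" for j
  proof (cases "j = r")
    case False
    have "int_comb G I y (c' j) = int_comb G (I - {i}) y (c' j)"
      using False yc Suc.prems by (intro int_comb_mono_neutral) (auto simp: c'_def)
    also have "\<dots> = int_comb G (I - {i}) y (c j)"
      using False yc by (intro int_comb_cong) (auto simp: c'_def)
    also have "\<dots> = \<one>" using c that False by simp
    finally show ?thesis .
  qed (simp add: c'_def b)
  moreover have "\<forall>j<Suc r. d j = 0" if d: "\<forall>l\<in>I. (\<Sum>j<Suc r. d j * c' j l) = 0" for d
  proof -
    have "(\<Sum>j<Suc r. d j * c' j i) = d r * b i"
      by (simp add: c'_def)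
    then have dr: "d r = 0" using d b by simp
    have "(\<Sum>j<r. d j * c j l) = 0" if "l \<in> I - {i}" for l
    proof -
      have "(\<Sum>j<Suc r. d j * c' j l) = (\<Sum>j<r. d j * c j l)"
        using that dr by (auto simp: c'_def intro!: sum.cong)
      then show ?thesis using d that by simp
    qed
    then have "\<forall>j<r. d j = 0" using c(2) by blast
    then show ?thesis using dr by (simp add: less_Suc_eq)
  qed
  ultimately show ?case by blast
qed auto

end

section \<open>Rank-nullity for homomorphisms of abelian groups\<close>

lemma (in group_hom) hom_int_comb:
  assumes "comm_group G" "comm_group H" "finite I" "x \<in> I \<rightarrow> carrier G"
  shows "h (int_comb G I x c) = int_comb H I (h \<circ> x) c"
  using assms(3,4)
proof (induction I)
  case (insert i I)
  interpret G: comm_group G by fact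
  interpret H: comm_group H by fact
  show ?case using insert
    by (simp add: G.int_comb_insert H.int_comb_insert hom_int_pow Pi_iff)
next
  case empty
  interpret G: comm_group G by fact
  interpret H: comm_group H by fact
  show ?case by simp
qed

lemma indep_sizes_subset: "S \<subseteq> T \<Longrightarrow> indep_sizes G S \<subseteq> indep_sizes G T"
  unfolding indep_sizes_def by blast

lemma finite_rank_subset: "finite_rank G T \<Longrightarrow> S \<subseteq> T \<Longrightarrow> finite_rank G S"
  unfolding finite_rank_def using indep_sizes_subset finite_subset by metis

locale comm_group_hom = group_hom G H h + G: comm_group G + H: comm_group H
  for G (structure) and H (structure) and h
begin

lemma int_indep_lift:
  assumes "finite I" "x \<in> I \<rightarrow> carrier G" "int_indep H I (h \<circ> x)"
  shows "int_indep G I x"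
  using assms hom_int_comb[OF G.comm_group_axioms H.comm_group_axioms assms(1,2)]
  unfolding int_indep_def by (metis hom_one)

lemma indep_sizes_image: "indep_sizes H (h ` carrier G) \<subseteq> indep_sizes G (carrier G)"
proof
  fix k assume "k \<in> indep_sizes H (h ` carrier G)"
  then obtain I :: "nat set" and y where I: "finite I" "y \<in> I \<rightarrow> h ` carrier G" "int_indep H I y" "k = card I"
    by (auto simp: indep_sizes_def)
  then have "\<forall>i\<in>I. \<exists>g\<in>carrier G. h g = y i" by (force simp: Pi_iff)
  then obtain x where x: "\<forall>i\<in>I. x i \<in> carrier G \<and> h (x i) = y i" by metis
  have "int_comb H I (h \<circ> x) c = int_comb H I y c" for c
    using x I(2) by (intro H.int_comb_cong) (auto simp: Pi_iff)
  then have "int_indep H I (h \<circ> x)" using I(3) by (simp add: int_indep_def)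
  then have "int_indep G I x" using int_indep_lift I(1) x by blast
  then show "k \<in> indep_sizes G (carrier G)"
    using I x unfolding indep_sizes_def by blast
qed

lemma finite_rank_image: "finite_rank G (carrier G) \<Longrightarrow> finite_rank H (h ` carrier G)"
  unfolding finite_rank_def using indep_sizes_image finite_subset by metis

lemma kernel_subset: "kernel G H h \<subseteq> carrier G"
  by (auto simp: kernel_def)

text \<open>For the upper bound, the images of too many independent elements satisfy more
  independent relations than the rank of the kernel allows. For the lower bound, an independent
  family of the kernel is continued by lifts of one of the image.\<close>

lemma indep_sizes_extension:
  assumes "finite_rank G (kernel G H h)" "finite_rank H (h ` carrier G)"
  shows "indep_sizes G (carrier G) = {..group_rank G (kernel G H h) + group_rank H (h ` carrier G)}"
    (is "_ = {..?r + ?s}")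
proof (rule antisym)
  have img: "h ` carrier G \<subseteq> carrier H" by auto
  show "indep_sizes G (carrier G) \<subseteq> {..?r + ?s}"
  proof (rule ccontr)
    assume "\<not> ?thesis"
    then obtain k where k: "k \<in> indep_sizes G (carrier G)" "k > ?r + ?s" by force
    then obtain I :: "nat set" and x
      where I: "finite I" "x \<in> I \<rightarrow> carrier G" "int_indep G I x" "card I = k"
      by (auto simp: indep_sizes_def)
    have "h \<circ> x \<in> I \<rightarrow> h ` carrier G" "card I \<ge> ?s + Suc ?r" using I k by auto
    from H.independent_relations[OF img assms(2) I(1) this]
    obtain c :: "nat \<Rightarrow> nat \<Rightarrow> int" where c: "\<And>j. j < Suc ?r \<Longrightarrow> int_comb H I (h \<circ> x) (c j) = \<one>\<^bsub>H\<^esub>"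
      "\<And>d. \<forall>i\<in>I. (\<Sum>j<Suc ?r. d j * c j i) = 0 \<Longrightarrow> (\<forall>j<Suc ?r. d j = 0)"
      by blast
    define z where "z j = int_comb G I x (c j)" for j
    have z: "z \<in> {..<Suc ?r} \<rightarrow> kernel G H h"
    proof
      fix j assume "j \<in> {..<Suc ?r}"
      then have "h (z j) = \<one>\<^bsub>H\<^esub>"
        unfolding z_def using c(1) I hom_int_comb[OF G.comm_group_axioms H.comm_group_axioms I(1,2)] by simp
      then show "z j \<in> kernel G H h" using I by (simp add: kernel_def z_def)
    qed
    have "int_indep G {..<Suc ?r} z"
      unfolding int_indep_def
    proof (intro allI impI)
      fix d assume "int_comb G {..<Suc ?r} z d = \<one>"
      then have "int_comb G I x (\<lambda>i. \<Sum>j<Suc ?r. d j * c j i) = \<one>"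
        using G.int_comb_comb[OF I(1,2), of "{..<Suc ?r}" c d] by (simp add: z_def[abs_def])
      then have "\<forall>i\<in>I. (\<Sum>j<Suc ?r. d j * c j i) = 0"
        using I(3) unfolding int_indep_def by blast
      then show "\<forall>j\<in>{..<Suc ?r}. d j = 0" using c(2) by blast
    qed
    then have "Suc ?r \<in> indep_sizes G (kernel G H h)"
      using z by (intro indep_sizesI[of "{..<Suc ?r}" z]) auto
    then show False using G.indep_sizes_eq[OF assms(1) kernel_subset] by auto
  qed
  have "?r + ?s \<in> indep_sizes G (carrier G)"
  proof -
    have "?r \<in> indep_sizes G (kernel G H h)"
      using G.indep_sizes_eq[OF assms(1) kernel_subset] by auto
    then obtain a where a: "a \<in> {..<?r} \<rightarrow> kernel G H h" "int_indep G {..<?r} a"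
      by (rule G.int_indep_on_index_set[OF _ kernel_subset, of _ "{..<?r}"]) auto
    have "?s \<in> indep_sizes H (h ` carrier G)"
      using H.indep_sizes_eq[OF assms(2) img] by auto
    then obtain y where y: "y \<in> {?r..<?r+?s} \<rightarrow> h ` carrier G" "int_indep H {?r..<?r+?s} y"
      by (rule H.int_indep_on_index_set[OF _ img, of _ "{?r..<?r+?s}"]) auto
    have "\<forall>i\<in>{?r..<?r+?s}. \<exists>g\<in>carrier G. h g = y i" using y(1) by (force simp: Pi_iff)
    then obtain b where b: "\<forall>i\<in>{?r..<?r+?s}. b i \<in> carrier G \<and> h (b i) = y i" by metis
    define x where "x i = (if i < ?r then a i else b i)" for i
    have x1: "x \<in> {..<?r} \<rightarrow> carrier G" and x2: "x \<in> {?r..<?r+?s} \<rightarrow> carrier G"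
      using a(1) kernel_subset b by (auto simp: x_def)
    have "int_indep G ({..<?r} \<union> {?r..<?r+?s}) x"
      unfolding int_indep_def
    proof (intro allI impI)
      fix c assume "int_comb G ({..<?r} \<union> {?r..<?r+?s}) x c = \<one>"
      then have *: "int_comb G {..<?r} x c \<otimes> int_comb G {?r..<?r+?s} x c = \<one>"
        using x1 x2 by (subst (asm) G.int_comb_Un_disjoint) auto
      have "h (int_comb G {..<?r} x c) = int_comb H {..<?r} (\<lambda>i. \<one>\<^bsub>H\<^esub>) c"
        using a(1) x1
        by (subst hom_int_comb[OF G.comm_group_axioms H.comm_group_axioms])
          (auto intro!: H.int_comb_cong simp: x_def kernel_def Pi_iff)
      also have "\<dots> = \<one>\<^bsub>H\<^esub>" by (simp add: int_comb_def)
      finally have h1: "h (int_comb G {..<?r} x c) = \<one>\<^bsub>H\<^esub>" .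
      have "h (int_comb G {?r..<?r+?s} x c) = int_comb H {?r..<?r+?s} y c"
        using b x2 img y
        by (subst hom_int_comb[OF G.comm_group_axioms H.comm_group_axioms])
          (auto intro!: H.int_comb_cong simp: x_def Pi_iff)
      moreover have "h (int_comb G {?r..<?r+?s} x c) = \<one>\<^bsub>H\<^esub>"
        using arg_cong[OF *, of h] h1 x1 x2 by (simp add: hom_mult)
      \<comment> \<open>Applying \<open>h\<close> removes the kernel part, so the coefficients of
        the lifts vanish first; what is left of the relation lies in the kernel.\<close>
      ultimately have "\<forall>i\<in>{?r..<?r+?s}. c i = 0"
        using y(2) by (simp add: int_indep_def)
      then have "int_comb G {?r..<?r+?s} x c = \<one>"
        unfolding int_comb_def by (intro G.finprod_one_eqI) auto
      then have "int_comb G {..<?r} x c = \<one>" using * x1 by simp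
      moreover have "int_comb G {..<?r} x c = int_comb G {..<?r} a c"
        using a(1) kernel_subset by (intro G.int_comb_cong) (auto simp: x_def)
      ultimately have "\<forall>i\<in>{..<?r}. c i = 0"
        using a(2) by (simp add: int_indep_def)
      with \<open>\<forall>i\<in>{?r..<?r+?s}. c i = 0\<close> show "\<forall>i\<in>{..<?r} \<union> {?r..<?r+?s}. c i = 0" by blast
    qed
    moreover have "x \<in> {..<?r} \<union> {?r..<?r+?s} \<rightarrow> carrier G" using x1 x2 by blast
    ultimately show ?thesis
      by (intro indep_sizesI[of "{..<?r} \<union> {?r..<?r+?s}" x]) (auto simp: ivl_disj_un)
  qed
  then show "{..?r + ?s} \<subseteq> indep_sizes G (carrier G)"
    using G.indep_sizes_downward by auto
qed

lemma
  assumes "finite_rank G (kernel G H h)" "finite_rank H (h ` carrier G)"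
  shows finite_rank_extension: "finite_rank G (carrier G)"
    and rank_extension: "group_rank G (carrier G) = group_rank G (kernel G H h) + group_rank H (h ` carrier G)"
  using indep_sizes_extension[OF assms] by (simp_all add: finite_rank_def group_rank_def Max_eq_iff)

lemma indep_sizes_iso:
  assumes "h \<in> iso G H"
  shows "indep_sizes G (carrier G) = indep_sizes H (carrier H)"
proof (rule antisym)
  have "h ` carrier G = carrier H" and inj: "inj_on h (carrier G)"
    using assms by (auto simp: iso_def bij_betw_def)
  then show "indep_sizes H (carrier H) \<subseteq> indep_sizes G (carrier G)"
    using indep_sizes_image by simp
  show "indep_sizes G (carrier G) \<subseteq> indep_sizes H (carrier H)"
  proof
    fix k assume "k \<in> indep_sizes G (carrier G)"
    then obtain I :: "nat set" and x
      where I: "finite I" "x \<in> I \<rightarrow> carrier G" "int_indep G I x" "k = card I"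
      by (auto simp: indep_sizes_def)
    have "int_indep H I (h \<circ> x)"
      unfolding int_indep_def
    proof (intro allI impI)
      fix c assume "int_comb H I (h \<circ> x) c = \<one>\<^bsub>H\<^esub>"
      then have "h (int_comb G I x c) = h \<one>"
        using hom_int_comb[OF G.comm_group_axioms H.comm_group_axioms I(1,2)] by simp
      then have "int_comb G I x c = \<one>"
        using inj_onD[OF inj] G.int_comb_closed[OF I(2)] G.one_closed by blast
      then show "\<forall>i\<in>I. c i = 0" using I(3) by (simp add: int_indep_def)
    qed
    then show "k \<in> indep_sizes H (carrier H)"
      using I by (intro indep_sizesI[of I "h \<circ> x"]) (auto simp: Pi_iff)
  qed
qed

end

lemma iso_imp_indep_sizes_eq:
  assumes "G \<cong> H" "comm_group G" "comm_group H"
  shows "indep_sizes G (carrier G) = indep_sizes H (carrier H)"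
proof -
  obtain h where h: "h \<in> iso G H" using assms(1) by (auto simp: is_iso_def)
  interpret comm_group_hom G H h
    using assms h by (auto simp: comm_group_hom_def group_hom_def group_hom_axioms_def comm_group_def iso_def)
  show ?thesis using indep_sizes_iso h by simp
qed

section \<open>Euler characteristics of pairs of spaces\<close>

text \<open>A relation instead of a function, because the degree from which the terms vanish is not
  known in advance; that there is one is part of the relation.\<close>

definition alternating_sum :: "(nat \<Rightarrow> nat) \<Rightarrow> int \<Rightarrow> bool" where
  "alternating_sum a e \<longleftrightarrow> (\<exists>N. (\<forall>p\<ge>N. a p = 0) \<and> e = (\<Sum>p<N. (-1) ^ p * int (a p)))"

lemma alternating_sum_beyond:
  assumes "\<forall>p\<ge>N. a p = 0" "N \<le> M"
  shows "(\<Sum>p<N. (-1) ^ p * int (a p)) = (\<Sum>p<M. (-1) ^ p * int (a p))"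
  using assms by (intro sum.mono_neutral_left) auto

lemma alternating_sum_unique:
  assumes "alternating_sum a e" "alternating_sum a e'"
  shows "e = e'"
  using assms alternating_sum_beyond unfolding alternating_sum_def by (metis nat_le_linear)

lemma alternating_sum_single:
  assumes "\<And>p. a p = (if p = n then 1 else 0)"
  shows "alternating_sum a ((-1) ^ n)"
  unfolding alternating_sum_def using assms
  by (intro exI[of _ "Suc n"]) (auto simp: if_distrib cong: if_cong)

text \<open>\<open>\<alpha>\<close>, \<open>\<beta>\<close> and \<open>\<gamma>\<close> stand for
  the ranks of the three kinds of maps in a long exact sequence, \<open>\<gamma> p\<close> for that
  of the connecting map from degree \<open>p\<close> of \<open>c\<close> to degree
  \<open>p - 1\<close> of \<open>a\<close>.\<close>

lemma alternating_sum_exact: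
  fixes \<alpha> \<beta> \<gamma> a b c :: "nat \<Rightarrow> nat"
  assumes ranks: "\<And>p. a p = \<gamma> (Suc p) + \<alpha> p" "\<And>p. b p = \<alpha> p + \<beta> p" "\<And>p. c p = \<beta> p + \<gamma> p"
    and "\<gamma> 0 = 0"
  shows "alternating_sum a e \<Longrightarrow> alternating_sum c e' \<Longrightarrow> alternating_sum b (e + e')"
    and "alternating_sum a e \<Longrightarrow> alternating_sum b e' \<Longrightarrow> alternating_sum c (e' - e)"
proof -
  have *: "int (b p) = int (a p) + int (c p) - int (\<gamma> (Suc p)) - int (\<gamma> p)" for p
    by (simp add: ranks)
  \<comment> \<open>The ranks of the connecting maps telescope; a cut after \<open>N\<close> terms
    leaves only \<open>\<gamma> N\<close>.\<close>
  have sum: "(\<Sum>p<N. (-1) ^ p * int (b p)) =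
      (\<Sum>p<N. (-1) ^ p * int (a p)) + (\<Sum>p<N. (-1) ^ p * int (c p)) + (-1) ^ N * int (\<gamma> N)" for N
    using \<open>\<gamma> 0 = 0\<close> by (induction N) (auto simp: * algebra_simps)
  show "alternating_sum b (e + e')" if a: "alternating_sum a e" and c: "alternating_sum c e'"
  proof -
    obtain N where N: "\<forall>p\<ge>N. a p = 0" "e = (\<Sum>p<N. (-1) ^ p * int (a p))"
      using a by (auto simp: alternating_sum_def)
    obtain M where M: "\<forall>p\<ge>M. c p = 0" "e' = (\<Sum>p<M. (-1) ^ p * int (c p))"
      using c by (auto simp: alternating_sum_def)
    have "\<forall>p\<ge>N+M. b p = 0" using N M by (auto simp: ranks)
    moreover have "\<gamma> (N + M) = 0" using M(1) by (simp add: ranks)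
    then have "(\<Sum>p<N+M. (-1) ^ p * int (b p)) = e + e'"
      using sum[of "N+M"] alternating_sum_beyond[OF N(1), of "N+M"] alternating_sum_beyond[OF M(1), of "N+M"]
        N(2) M(2) by simp
    ultimately show ?thesis unfolding alternating_sum_def by metis
  qed
  show "alternating_sum c (e' - e)" if a: "alternating_sum a e" and b: "alternating_sum b e'"
  proof -
    obtain N where N: "\<forall>p\<ge>N. a p = 0" "e = (\<Sum>p<N. (-1) ^ p * int (a p))"
      using a by (auto simp: alternating_sum_def)
    obtain M where M: "\<forall>p\<ge>M. b p = 0" "e' = (\<Sum>p<M. (-1) ^ p * int (b p))"
      using b by (auto simp: alternating_sum_def)
    \<comment> \<open>That \<open>c\<close> vanishes eventually has to be derived here. Since
      \<open>\<gamma> (Suc p) \<le> a p\<close>, \<open>\<gamma>\<close> vanishes one degree later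
      than \<open>a\<close>, hence the cut at \<open>Suc (N + M)\<close>.\<close>
    have g: "\<gamma> p = 0" if "p \<ge> Suc N" for p
      using that N(1) ranks(1)[of "p - 1"] by auto
    have "\<forall>p\<ge>Suc(N+M). c p = 0" using M g by (auto simp: ranks)
    moreover have "(\<Sum>p<Suc(N+M). (-1) ^ p * int (c p)) = e' - e"
      using sum[of "Suc(N+M)"] alternating_sum_beyond[OF N(1), of "Suc(N+M)"]
        alternating_sum_beyond[OF M(1), of "Suc(N+M)"] N(2) M(2) g[of "Suc(N+M)"] by simp
    ultimately show ?thesis unfolding alternating_sum_def by metis
  qed
qed

section \<open>Betti numbers and Euler characteristics of pairs\<close>

definition betti :: "int \<Rightarrow> 'a topology \<Rightarrow> 'a set \<Rightarrow> nat" where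
  "betti p X S = group_rank (relative_homology_group p X S) (carrier (relative_homology_group p X S))"

text \<open>Finite rank is demanded in all integer degrees, because the exact sequence at degree 0
  reaches degree -1.\<close>

definition has_euler :: "'a topology \<Rightarrow> 'a set \<Rightarrow> int \<Rightarrow> bool" where
  "has_euler X S e \<longleftrightarrow>
     (\<forall>p. finite_rank (relative_homology_group p X S) (carrier (relative_homology_group p X S))) \<and>
     alternating_sum (\<lambda>p. betti (int p) X S) e"

lemma has_euler_unique: "has_euler X S e \<Longrightarrow> has_euler X S e' \<Longrightarrow> e = e'"
  using alternating_sum_unique by (auto simp: has_euler_def)

lemma has_euler_iso:
  assumes "has_euler X S e" "\<And>p. relative_homology_group p X S \<cong> relative_homology_group p Y T"
  shows "has_euler Y T e"
proof -
  have *: "indep_sizes (relative_homology_group p X S) (carrier (relative_homology_group p X S)) =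
      indep_sizes (relative_homology_group p Y T) (carrier (relative_homology_group p Y T))" for p
    using iso_imp_indep_sizes_eq[OF assms(2)] by simp
  show ?thesis
    using assms(1) by (simp add: has_euler_def finite_rank_def betti_def group_rank_def *)
qed

lemma indep_sizes_trivial:
  assumes "trivial_group G" "comm_group G"
  shows "indep_sizes G (carrier G) = {0}"
proof -
  interpret comm_group G by fact
  have c: "carrier G = {\<one>\<^bsub>G\<^esub>}" using assms(1) by (auto simp: trivial_group_def)
  have "card I = 0" if "finite (I :: nat set)" "x \<in> I \<rightarrow> carrier G" "int_indep G I x" for I x
  proof -
    have "x i [^]\<^bsub>G\<^esub> (1::int) = \<one>\<^bsub>G\<^esub>" if "i \<in> I" for i
      using \<open>x \<in> I \<rightarrow> carrier G\<close> that c by (auto simp: Pi_iff)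
    then have "int_comb G I x (\<lambda>_. 1) = \<one>\<^bsub>G\<^esub>"
      unfolding int_comb_def by (intro finprod_one_eqI)
    then have "\<forall>i\<in>I. (1::int) = 0"
      using that(3)[unfolded int_indep_def, THEN spec, of "\<lambda>_. 1"] by simp
    then show ?thesis by auto
  qed
  then have "indep_sizes G (carrier G) \<subseteq> {0}"
    by (auto elim: indep_sizesE)
  then show ?thesis
    using zero_in_indep_sizes by blast
qed

lemma indep_sizes_integer_group: "indep_sizes integer_group (carrier integer_group) = {0, 1}"
proof -
  interpret comm_group integer_group by (rule abelian_integer_group)
  have pow: "x [^]\<^bsub>integer_group\<^esub> (c::int) = c * x" for x c by simp
  have comb: "int_comb integer_group I x c = (\<Sum>i\<in>I. c i * x i)" if "finite I" for I :: "nat set" and x c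
    using that by (induction I) (auto simp: int_comb_insert)
  have "card I \<le> 1" if I: "finite (I :: nat set)" "int_indep integer_group I x" for I x
  proof (rule ccontr)
    assume "\<not> card I \<le> 1"
    then obtain i j where ij: "i \<in> I" "j \<in> I" "i \<noteq> j"
      by (metis I(1) One_nat_def card_le_Suc0_iff_eq)
    have ind: "\<forall>i\<in>I. c i = 0" if "(\<Sum>i\<in>I. c i * x i) = 0" for c
      using I(2) that by (simp add: int_indep_def comb[OF I(1)])
    have two: "(\<Sum>k\<in>I. (if k = i then a else if k = j then b else 0) * x k) = a * x i + b * x j" for a b
    proof -
      have "(\<Sum>k\<in>I. (if k = i then a else if k = j then b else 0) * x k) =
        (\<Sum>k\<in>{i,j}. (if k = i then a else if k = j then b else 0) * x k)"
        using I(1) ij by (intro sum.mono_neutral_right) auto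
      then show ?thesis using ij by simp
    qed
    \<comment> \<open>Two integers satisfy \<open>x j * x i - x i * x j = 0\<close>. This forces
      \<open>x j = 0\<close>, and then \<open>j\<close> alone is dependent.\<close>
    have "x j = 0"
      using bspec[OF ind[of "\<lambda>k. if k = i then x j else if k = j then - x i else 0"] ij(1)]
        two[of "x j" "- x i"] by simp
    then show False
      using bspec[OF ind[of "\<lambda>k. if k = i then 0 else if k = j then 1 else 0"] ij(2)] two[of 0 1] ij
      by simp
  qed
  then have "indep_sizes integer_group (carrier integer_group) \<subseteq> {..1}"
    by (auto elim!: indep_sizesE)
  moreover have "1 \<in> indep_sizes integer_group (carrier integer_group)"
    by (intro indep_sizesI[of "{0}" "\<lambda>_. 1"]) (auto simp: int_indep_def comb)
  moreover have "{..1::nat} = {0, 1}" by auto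
  ultimately show ?thesis using zero_in_indep_sizes[of "carrier integer_group"] by auto
qed

lemma
  assumes "trivial_group (relative_homology_group p X S)"
  shows betti_trivial: "betti p X S = 0"
    and finite_rank_trivial_homology:
      "finite_rank (relative_homology_group p X S) (carrier (relative_homology_group p X S))"
  using indep_sizes_trivial[OF assms] by (simp_all add: betti_def group_rank_def finite_rank_def)

lemma
  assumes "relative_homology_group p X S \<cong> integer_group"
  shows betti_integer: "betti p X S = 1"
    and finite_rank_integer_homology:
      "finite_rank (relative_homology_group p X S) (carrier (relative_homology_group p X S))"
proof -
  have "indep_sizes (relative_homology_group p X S) (carrier (relative_homology_group p X S)) = {0, 1}"
    using iso_imp_indep_sizes_eq[OF assms] indep_sizes_integer_group by (simp add: abelian_integer_group)
  then show "betti p X S = 1"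
    "finite_rank (relative_homology_group p X S) (carrier (relative_homology_group p X S))"
    by (simp_all add: betti_def group_rank_def finite_rank_def)
qed

lemma has_euler_like_sphere:
  assumes "relative_homology_group (int n) X S \<cong> integer_group"
    "\<And>p. p \<noteq> int n \<Longrightarrow> trivial_group (relative_homology_group p X S)"
  shows "has_euler X S ((-1) ^ n)"
proof -
  have "finite_rank (relative_homology_group p X S) (carrier (relative_homology_group p X S))" for p
    using finite_rank_integer_homology[OF assms(1)] finite_rank_trivial_homology[OF assms(2)] by metis
  moreover have "betti (int p) X S = (if p = n then 1 else 0)" for p
    using betti_integer[OF assms(1)] betti_trivial[OF assms(2)] by simp
  ultimately show ?thesis
    by (simp add: has_euler_def alternating_sum_single)
qed

lemma has_euler_contractible:
  assumes "contractible_space X" "topspace X \<noteq> {}"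
  shows "has_euler X {} 1"
proof -
  obtain a where a: "X homotopy_equivalent_space subtopology X {a}" "a \<in> topspace X"
    using assms by (auto simp: contractible_eq_homotopy_equivalent_singleton_subtopology)
  have iso: "homology_group p X \<cong> homology_group p (subtopology X {a})" for p
    using a(1) by (rule homotopy_equivalent_space_imp_isomorphic_homology_groups)
  have top: "topspace (subtopology X {a}) = {a}" using a by auto
  have "has_euler (subtopology X {a}) {} ((-1) ^ 0)"
    using homology_coefficients[OF top] homology_dimension_axiom[OF top]
    by (intro has_euler_like_sphere) simp_all
  then have "has_euler X {} ((-1) ^ 0)"
    by (rule has_euler_iso) (rule group.iso_sym[OF _ iso], simp)
  then show ?thesis by simp
qed

lemma has_euler_empty:
  assumes "topspace X = {}"
  shows "has_euler X S 0"
  using trivial_relative_homology_group_empty[OF assms]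
  by (auto simp: has_euler_def betti_trivial finite_rank_trivial_homology alternating_sum_def)

text \<open>Additivity along the long exact sequence of a pair. The first direction builds a
  polyhedron up from a subcomplex, the second evaluates pairs of polyhedra.\<close>

lemma
  fixes X :: "'a topology" and S :: "'a set"
  shows has_euler_extension: "has_euler (subtopology X S) {} e \<Longrightarrow> has_euler X S e' \<Longrightarrow> has_euler X {} (e + e')"
    and has_euler_relative: "has_euler (subtopology X S) {} e \<Longrightarrow> has_euler X {} e' \<Longrightarrow> has_euler X S (e' - e)"
proof -
  define A where "A p = homology_group p (subtopology X S)" for p
  define B where "B p = homology_group p X" for p
  define C where "C p = relative_homology_group p X S" for p
  define f where "f p = hom_induced p (subtopology X S) {} X {} id" for p
  define g where "g p = hom_induced p X {} X S id" for p
  define d where "d p = hom_boundary p X S" for p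
  note defs = A_def B_def C_def f_def g_def d_def
  have comm: "comm_group (A p)" "comm_group (B p)" "comm_group (C p)" for p
    by (simp_all add: defs)
  have hom: "f p \<in> hom (A p) (B p)" "g p \<in> hom (B p) (C p)" "d p \<in> hom (C p) (A (p - 1))" for p
    by (simp_all add: defs hom_induced_hom hom_boundary_hom)
  \<comment> \<open>Exactness as equality of a kernel with an image: each image is the kernel of the
    next map, so its rank enters two of the rank formulas.\<close>
  have kg: "kernel (B p) (C p) (g p) = f p ` carrier (A p)" for p
    using homology_exactness_axiom_3[of p X S] by (simp add: defs)
  have kd: "kernel (C p) (A (p - 1)) (d p) = g p ` carrier (B p)" for p
    using homology_exactness_axiom_1[of p X S] by (simp add: defs)
  have kf: "kernel (A (p - 1)) (B (p - 1)) (f (p - 1)) = d p ` carrier (C p)" for p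
    using homology_exactness_axiom_2[of p X S] by (simp add: defs)
  have cgh: "comm_group_hom G H h" if "comm_group G" "comm_group H" "h \<in> hom G H"
    for G H :: "'a chain set monoid" and h
    using that by (simp add: comm_group_hom_def group_hom_def group_hom_axioms_def comm_group_def)
  note F = cgh[OF comm(1,2) hom(1)] and G = cgh[OF comm(2,3) hom(2)] and D = cgh[OF comm(3) comm(1) hom(3)]
  let ?fin = "\<lambda>G. \<forall>p. finite_rank (G p) (carrier (G p))"
  have sub: "f p ` carrier (A p) \<subseteq> carrier (B p)" "g p ` carrier (B p) \<subseteq> carrier (C p)"
     "d p ` carrier (C p) \<subseteq> carrier (A (p - 1))" for p
    using hom unfolding hom_def by blast+
  have finB: "?fin B" if "?fin A" "?fin C"
  proof
    fix p
    have "finite_rank (B p) (kernel (B p) (C p) (g p))"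
      unfolding kg using that(1) by (intro comm_group_hom.finite_rank_image[OF F]) blast
    moreover have "finite_rank (C p) (g p ` carrier (B p))"
      using that(2) finite_rank_subset[OF _ sub(2)] by blast
    ultimately show "finite_rank (B p) (carrier (B p))"
      by (rule comm_group_hom.finite_rank_extension[OF G])
  qed
  have finC: "?fin C" if "?fin A" "?fin B"
  proof
    fix p
    have "finite_rank (C p) (kernel (C p) (A (p - 1)) (d p))"
      unfolding kd using that(2) by (intro comm_group_hom.finite_rank_image[OF G]) blast
    moreover have "finite_rank (A (p - 1)) (d p ` carrier (C p))"
      using that(1) finite_rank_subset[OF _ sub(3)] by blast
    ultimately show "finite_rank (C p) (carrier (C p))"
      by (rule comm_group_hom.finite_rank_extension[OF D])
  qed
  define \<alpha> where "\<alpha> p = group_rank (B (int p)) (f (int p) ` carrier (A (int p)))" for p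
  define \<beta> where "\<beta> p = group_rank (C (int p)) (g (int p) ` carrier (B (int p)))" for p
  define \<gamma> where "\<gamma> p = group_rank (A (int p - 1)) (d (int p) ` carrier (C (int p)))" for p
  have ranks: "group_rank (A (int p)) (carrier (A (int p))) = \<gamma> (Suc p) + \<alpha> p"
    "group_rank (B (int p)) (carrier (B (int p))) = \<alpha> p + \<beta> p"
    "group_rank (C (int p)) (carrier (C (int p))) = \<beta> p + \<gamma> p" if fin: "?fin A" "?fin B" "?fin C" for p
  proof -
    have fi: "finite_rank (B q) (f q ` carrier (A q))" "finite_rank (C q) (g q ` carrier (B q))"
       "finite_rank (A (q - 1)) (d q ` carrier (C q))" for q
      by (rule finite_rank_subset[OF spec[OF fin(2)] sub(1)] finite_rank_subset[OF spec[OF fin(3)] sub(2)]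
          finite_rank_subset[OF spec[OF fin(1)] sub(3)])+
    show "group_rank (B (int p)) (carrier (B (int p))) = \<alpha> p + \<beta> p"
      using comm_group_hom.rank_extension[OF G] fi kg by (simp add: \<alpha>_def \<beta>_def)
    show "group_rank (C (int p)) (carrier (C (int p))) = \<beta> p + \<gamma> p"
      using comm_group_hom.rank_extension[OF D] fi kd by (simp add: \<beta>_def \<gamma>_def)
    show "group_rank (A (int p)) (carrier (A (int p))) = \<gamma> (Suc p) + \<alpha> p"
      \<comment> \<open>The kernel of \<open>f\<close> in degree \<open>p\<close> is the image of
        the boundary map from degree \<open>p + 1\<close>, which accounts for
        \<open>\<gamma> (Suc p)\<close>.\<close>
      using comm_group_hom.rank_extension[OF F, of "int p"] fi(1)[of "int p"] fi(3)[of "int p + 1"] kf[of "int p + 1"]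
      by (simp add: \<alpha>_def \<gamma>_def add.commute)
  qed
  \<comment> \<open>The boundary map out of degree 0 ends in degree -1, where homology is
    trivial.\<close>
  have \<gamma>0: "\<gamma> 0 = 0"
  proof -
    have s: "indep_sizes (A (-1)) (carrier (A (-1))) = {0}"
      by (intro indep_sizes_trivial comm) (simp add: A_def)
    then have "indep_sizes (A (-1)) (d 0 ` carrier (C 0)) \<subseteq> {0}"
      using indep_sizes_subset[OF sub(3)[of 0], of "A (-1)"] by simp
    moreover have "0 \<in> indep_sizes (A (-1)) (d 0 ` carrier (C 0))"
      by (rule comm_group.zero_in_indep_sizes[OF comm(1)])
    ultimately have "indep_sizes (A (-1)) (d 0 ` carrier (C 0)) = {0}" by blast
    then show ?thesis by (simp add: \<gamma>_def group_rank_def)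
  qed
  have he: "has_euler (subtopology X S) {} e \<longleftrightarrow> ?fin A \<and> alternating_sum (\<lambda>p. group_rank (A (int p)) (carrier (A (int p)))) e"
     "has_euler X {} e \<longleftrightarrow> ?fin B \<and> alternating_sum (\<lambda>p. group_rank (B (int p)) (carrier (B (int p)))) e"
     "has_euler X S e \<longleftrightarrow> ?fin C \<and> alternating_sum (\<lambda>p. group_rank (C (int p)) (carrier (C (int p)))) e" for e
    by (simp_all add: has_euler_def betti_def A_def B_def C_def)
  show "has_euler X {} (e + e')" if "has_euler (subtopology X S) {} e" "has_euler X S e'"
  proof -
    have fin: "?fin A" "?fin C" using that unfolding he by simp_all
    note fin' = fin(1) finB[OF fin] fin(2)
    show ?thesis
      using that alternating_sum_exact(1)[OF ranks[OF fin'] \<gamma>0] fin' unfolding he by simp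
  qed
  show "has_euler X S (e' - e)" if "has_euler (subtopology X S) {} e" "has_euler X {} e'"
  proof -
    have fin: "?fin A" "?fin B" using that unfolding he by simp_all
    note fin' = fin finC[OF fin]
    show ?thesis
      using that alternating_sum_exact(2)[OF ranks[OF fin'] \<gamma>0] fin' unfolding he by simp
  qed
qed

section \<open>Polyhedra\<close>

abbreviation support :: "('v \<Rightarrow> real) \<Rightarrow> 'v set" where
  "support x \<equiv> {v. x v \<noteq> 0}"

definition polyhedron :: "'v set set \<Rightarrow> ('v \<Rightarrow> real) set" where
  "polyhedron K = {x. (\<forall>v. 0 \<le> x v) \<and> support x \<in> K \<and> (\<Sum>v\<in>support x. x v) = 1}"

lemma realization_eq: "realization K = top_of_set (polyhedron K)"
  by (simp add: realization_def polyhedron_def euclidean_product_topology)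

lemma topspace_realization [simp]: "topspace (realization K) = polyhedron K"
  by (simp add: realization_eq)

lemma polyhedron_mono: "L \<subseteq> K \<Longrightarrow> polyhedron L \<subseteq> polyhedron K"
  by (auto simp: polyhedron_def)

lemma subtopology_realization:
  "L \<subseteq> K \<Longrightarrow> subtopology (realization K) (polyhedron L) = realization L"
  using polyhedron_mono[of L K] by (simp add: realization_eq subtopology_subtopology Int_absorb1)

lemma sum_support_superset:
  fixes x :: "'v \<Rightarrow> real"
  assumes "finite V" "support x \<subseteq> V"
  shows "(\<Sum>v\<in>support x. x v) = (\<Sum>v\<in>V. x v)"
  using assms by (intro sum.mono_neutral_left) auto

lemma finite_simplicial_complexD:
  assumes "finite_simplicial_complex K"
  shows "finite K" "s \<in> K \<Longrightarrow> finite s" "s \<in> K \<Longrightarrow> s \<noteq> {}" "s \<in> K \<Longrightarrow> t \<subseteq> s \<Longrightarrow> t \<noteq> {} \<Longrightarrow> t \<in> K"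
    "finite (\<Union>K)"
  using assms unfolding finite_simplicial_complex_def by (blast, blast, blast, meson, blast)

text \<open>Any simplex containing the support may serve as witness: the sum being 1 keeps the
  support from being empty, so it is a face of \<open>s\<close>.\<close>

lemma polyhedronI:
  assumes "finite_simplicial_complex K" "\<And>v. 0 \<le> x v" "support x \<subseteq> s" "s \<in> K" "(\<Sum>v\<in>s. x v) = 1"
  shows "x \<in> polyhedron K"
proof -
  have fin: "finite s" using finite_simplicial_complexD(2)[OF assms(1,4)] .
  have "(\<Sum>v\<in>support x. x v) = 1"
    using sum_support_superset[OF fin assms(3)] assms(5) by simp
  moreover from this have "support x \<noteq> {}" by (metis sum.empty zero_neq_one)
  then have "support x \<in> K" using finite_simplicial_complexD(4)[OF assms(1,4,3)] by blast
  ultimately show ?thesis using assms(2) by (simp add: polyhedron_def)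
qed

lemma polyhedronD:
  assumes "x \<in> polyhedron K"
  shows "0 \<le> x v" "support x \<in> K" "(\<Sum>v\<in>support x. x v) = 1"
  using assms by (auto simp: polyhedron_def)

lemma polyhedron_sum:
  assumes "finite_simplicial_complex K" "x \<in> polyhedron K"
  shows "(\<Sum>v\<in>\<Union>K. x v) = 1"
proof -
  have "support x \<subseteq> \<Union>K" using polyhedronD(2)[OF assms(2)] by blast
  then show ?thesis
    using sum_support_superset[OF finite_simplicial_complexD(5)[OF assms(1)]] polyhedronD(3)[OF assms(2)]
    by simp
qed

lemma barycenter:
  assumes "finite_simplicial_complex K" "s \<in> K"
  obtains x where "x \<in> polyhedron K" "support x = s"
proof -
  let ?x = "\<lambda>v. if v \<in> s then 1 / real (card s) else 0"
  note D = finite_simplicial_complexD(2,3)[OF assms]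
  have supp: "support ?x = s" using D by auto
  have "(\<Sum>v\<in>s. ?x v) = 1" using D by simp
  then have "?x \<in> polyhedron K" using supp by (intro polyhedronI[OF assms(1) _ _ assms(2)]) auto
  with supp that show thesis by blast
qed

lemma finite_simplicial_complex_subset:
  assumes "finite_simplicial_complex K" "L \<subseteq> K" "\<And>s t. s \<in> L \<Longrightarrow> t \<subseteq> s \<Longrightarrow> t \<in> K \<Longrightarrow> t \<in> L"
  shows "finite_simplicial_complex L"
  using assms unfolding finite_simplicial_complex_def by (meson finite_subset subsetD)

section \<open>Continuity and deformations of polyhedra\<close>

lemma continuous_on_snd_coordinate [continuous_intros]:
  fixes S :: "('a::topological_space \<times> ('v \<Rightarrow> real)) set"
  shows "continuous_on S (\<lambda>p. snd p v)"
  by (rule continuous_on_product_then_coordinatewise[where f = snd, OF continuous_on_snd[OF continuous_on_id]])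

lemma continuous_on_Min:
  fixes f :: "'i \<Rightarrow> 'a::topological_space \<Rightarrow> real"
  assumes "finite I" "I \<noteq> {}" "\<And>i. i \<in> I \<Longrightarrow> continuous_on S (f i)"
  shows "continuous_on S (\<lambda>x. Min ((\<lambda>i. f i x) ` I))"
  using assms
proof (induction I rule: finite_ne_induct)
  case (insert i I)
  have "Min ((\<lambda>i. f i x) ` insert i I) = min (f i x) (Min ((\<lambda>i. f i x) ` I))" for x
    using insert.hyps by simp
  then show ?case
    using insert by (simp add: continuous_on_min)
qed simp

lemma homotopic_with_canonI:
  assumes "continuous_on ({0..1} \<times> S) h" "\<And>t x. t \<in> {0..1::real} \<Longrightarrow> x \<in> S \<Longrightarrow> h (t, x) \<in> T"
    and "\<And>x. h (0, x) = f x" "\<And>x. h (1, x) = g x" "\<And>t. t \<in> {0..1} \<Longrightarrow> P (\<lambda>x. h (t, x))"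
  shows "homotopic_with_canon P S T f g"
proof -
  have "continuous_map (prod_topology (top_of_set {0..1}) (top_of_set S)) (top_of_set T) h"
    using assms(1,2) by (auto simp: continuous_map_in_subtopology prod_topology_subtopology_eu)
  with assms(3-5) show ?thesis
    unfolding homotopic_with_def by (intro exI[of _ h] conjI allI ballI)
qed

text \<open>The polyhedron consists of all points supported in \<open>s\<close> and is convex, so it
  contracts along straight lines.\<close>

lemma contractible_polyhedron_simplex:
  assumes "finite_simplicial_complex K" "s \<in> K" "\<And>t. t \<in> K \<Longrightarrow> t \<subseteq> s"
  shows "contractible_space (realization K)"
proof -
  obtain x where x: "x \<in> polyhedron K" "support x = s" using barycenter[OF assms(1,2)] .
  define h where "h = (\<lambda>(t::real, y) v. (1 - t) * y v + t * x v)"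
  have s: "\<Union>K = s" using assms(2,3) by blast
  have "homotopic_with_canon (\<lambda>_. True) (polyhedron K) (polyhedron K) id (\<lambda>_. x)"
  proof (rule homotopic_with_canonI)
    show "continuous_on ({0..1} \<times> polyhedron K) h"
      unfolding h_def case_prod_unfold
      by (intro continuous_on_coordinatewise_then_product continuous_intros)
    show "h (t, y) \<in> polyhedron K" if "t \<in> {0..1}" "y \<in> polyhedron K" for t y
    proof (rule polyhedronI[OF assms(1) _ _ assms(2)])
      show "0 \<le> h (t, y) v" for v
        using that(1) polyhedronD(1)[OF x(1), of v] polyhedronD(1)[OF that(2), of v]
        unfolding h_def split_conv by (intro add_nonneg_nonneg mult_nonneg_nonneg) auto
      show "support (h (t, y)) \<subseteq> s"
        using assms(3)[OF polyhedronD(2)[OF that(2)]] x(2) by (auto simp: h_def)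
      show "(\<Sum>v\<in>s. h (t, y) v) = 1"
        using polyhedron_sum[OF assms(1) that(2)] polyhedron_sum[OF assms(1) x(1)]
        by (simp add: h_def s sum.distrib flip: sum_distrib_left)
    qed
  qed (auto simp: h_def)
  then show ?thesis unfolding contractible_space_def realization_eq by (rule exI[of _ x])
qed

text \<open>Pushing points away from \<open>x\<close> until a coordinate of the carrier of \<open>x\<close> vanishes.\<close>

lemma relative_homology_punctured:
  assumes K: "finite_simplicial_complex K" and x: "x \<in> polyhedron K"
  defines "L \<equiv> {t \<in> K. \<not> support x \<subseteq> t}"
  shows "relative_homology_group p (realization K) (polyhedron L) \<cong>
    relative_homology_group p (realization K) (polyhedron K - {x})"
proof -
  let ?s = "support x" and ?U = "polyhedron K - {x}" and ?V = "\<Union>K"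
  have s: "finite ?s" "?s \<noteq> {}" "?s \<subseteq> ?V"
    using finite_simplicial_complexD(2,3)[OF K polyhedronD(2)[OF x]] polyhedronD(2)[OF x] by (simp_all add: Union_upper)
  have finV: "finite ?V" using finite_simplicial_complexD(5)[OF K] .
  have xpos: "x v > 0" if "v \<in> ?s" for v
    using polyhedronD(1)[OF x, of v] that by auto
  \<comment> \<open>\<open>m y\<close> is the largest multiple of \<open>x\<close> that can be
    subtracted from \<open>y\<close> without producing a negative coordinate. The minimum is
    attained, so the subtraction makes a coordinate in the carrier of \<open>x\<close>
    vanish.\<close>
  define m where "m y = Min ((\<lambda>v. y v / x v) ` ?s)" for y
  have m_le: "m y * x v \<le> y v" if "v \<in> ?s" for v y
  proof -
    have "m y \<le> y v / x v" unfolding m_def using s that by (intro Min_le) auto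
    then show ?thesis using xpos[OF that] by (simp add: pos_le_divide_eq)
  qed
  have m_att: "\<exists>v\<in>?s. m y * x v = y v" for y
  proof -
    have "m y \<in> (\<lambda>v. y v / x v) ` ?s" unfolding m_def using s by (intro Min_in) auto
    then obtain v where v: "v \<in> ?s" "m y = y v / x v" by blast
    then show ?thesis using xpos[OF v(1)] by (intro bexI[of _ v]) auto
  qed
  have m_nonneg: "m y \<ge> 0" if "y \<in> polyhedron K" for y
  proof -
    obtain v where v: "v \<in> ?s" "m y * x v = y v" using m_att by blast
    then show ?thesis using xpos[OF v(1)] polyhedronD(1)[OF that, of v]
      by (metis zero_le_mult_iff not_less)
  qed
  have sumx: "(\<Sum>v\<in>?V. x v) = 1" using polyhedron_sum[OF K x] .
  \<comment> \<open>If \<open>m y \<ge> 1\<close>, then \<open>y\<close> dominates \<open>x\<close>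
    in every coordinate; as both sum to 1, they are equal.\<close>
  have m_less: "m y < 1" if y: "y \<in> ?U" for y
  proof (rule ccontr)
    assume "\<not> m y < 1"
    have le: "x v \<le> y v" for v
    proof (cases "v \<in> ?s")
      case True
      have "1 * x v \<le> m y * x v" using \<open>\<not> m y < 1\<close> xpos[OF True] by (intro mult_right_mono) auto
      then show ?thesis using m_le[OF True, of y] by simp
    next
      case False
      then show ?thesis using y polyhedronD(1)[of y K v] by simp
    qed
    have "(\<Sum>v\<in>?V. y v - x v) = 0"
      using sumx polyhedron_sum[OF K, of y] y by (simp add: sum_subtractf)
    then have eqV: "\<forall>v\<in>?V. y v - x v = 0"
      using finV le by (subst (asm) sum_nonneg_eq_0_iff) auto
    have "y v = x v" for v
    proof (cases "v \<in> ?V")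
      case False
      then have "v \<notin> support y" "v \<notin> ?s" using polyhedronD(2)[of y K] y s(3) by blast+
      then show ?thesis by simp
    qed (use eqV in auto)
    then show False using y by auto
  qed
  \<comment> \<open>Subtract a part of \<open>m y * x\<close> and divide by the remaining sum. Time
    1 is the identity and time 0 lands in \<open>L\<close>; supports only shrink, so
    \<open>L\<close> is mapped into itself throughout.\<close>
  define h where "h = (\<lambda>(t::real, y) v. (y v - (1 - t) * m y * x v) / (1 - (1 - t) * m y))"
  have den: "1 - (1 - t) * m y > 0" if "t \<in> {0..1}" "y \<in> ?U" for t y
  proof -
    have "(1 - t) * m y \<le> 1 * m y" using that m_nonneg[of y] by (intro mult_right_mono) auto
    then show ?thesis using m_less[OF that(2)] by simp
  qed
  have num: "0 \<le> y v - (1 - t) * m y * x v" if "t \<in> {0..1}" "y \<in> ?U" for t y v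
  proof (cases "v \<in> ?s")
    case True
    have "(1 - t) * (m y * x v) \<le> 1 * (m y * x v)"
      using that m_nonneg[of y] xpos[OF True] by (intro mult_right_mono) auto
    then show ?thesis using m_le[OF True, of y] by (simp add: mult.assoc)
  next
    case False
    then show ?thesis using that polyhedronD(1)[of y K v] by simp
  qed
  have supp: "support (h (t, y)) \<subseteq> support y" if "t \<in> {0..1}" "y \<in> ?U" for t y
  proof
    fix v assume v: "v \<in> support (h (t, y))"
    show "v \<in> support y"
    proof (rule ccontr)
      assume "v \<notin> support y"
      then have yv: "y v = 0" by simp
      have "0 \<le> (1 - t) * m y * x v"
        using that m_nonneg[of y] polyhedronD(1)[OF x, of v] by simp
      then have "(1 - t) * m y * x v = 0" using num[OF that, of v] yv by simp
      then have "h (t, y) v = 0" using yv by (simp add: h_def)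
      then show False using v by simp
    qed
  qed
  have hK: "h (t, y) \<in> polyhedron K" if "t \<in> {0..1}" "y \<in> ?U" for t y
  proof (rule polyhedronI[OF K _ supp[OF that]])
    show "0 \<le> h (t, y) v" for v
      using num[OF that, of v] den[OF that] by (simp add: h_def)
    show yK: "support y \<in> K" using that polyhedronD(2) by blast
    have "support y \<subseteq> ?V" using yK by blast
    then have "(\<Sum>v\<in>support y. h (t, y) v) = (\<Sum>v\<in>?V. h (t, y) v)"
      using supp[OF that] finV by (intro sum.mono_neutral_left) auto
    also have "\<dots> = (\<Sum>v\<in>?V. y v - (1 - t) * m y * x v) / (1 - (1 - t) * m y)"
      by (simp add: h_def sum_divide_distrib)
    also have "(\<Sum>v\<in>?V. y v - (1 - t) * m y * x v) = 1 - (1 - t) * m y"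
      using sumx polyhedron_sum[OF K, of y] that by (simp add: sum_subtractf flip: sum_distrib_left)
    finally show "(\<Sum>v\<in>support y. h (t, y) v) = 1" using den[OF that] by simp
  qed
  have hU: "h (t, y) \<in> ?U" if "t \<in> {0..1}" "y \<in> ?U" for t y
  proof -
    \<comment> \<open>\<open>y\<close> lies on the segment from \<open>x\<close> to
      \<open>h (t, y)\<close>, so \<open>h (t, y) = x\<close> would give
      \<open>y = x\<close>.\<close>
    have "h (t, y) \<noteq> x"
    proof
      assume *: "h (t, y) = x"
      have "y v = x v" for v
      proof -
        have "(y v - (1 - t) * m y * x v) / (1 - (1 - t) * m y) = x v"
          using fun_cong[OF *, of v] by (simp add: h_def)
        then have "y v - (1 - t) * m y * x v = x v * (1 - (1 - t) * m y)"
          using den[OF that] by (simp add: field_simps)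
        then show ?thesis by (simp add: algebra_simps)
      qed
      then show False using that by auto
    qed
    then show ?thesis using hK[OF that] by simp
  qed
  have LU: "polyhedron L \<subseteq> ?U"
    using polyhedron_mono[of L K] by (auto simp: L_def polyhedron_def)
  have hL: "h (t, y) \<in> polyhedron L" if "t \<in> {0..1}" "y \<in> polyhedron L" for t y
  proof -
    have y: "y \<in> ?U" using LU that by blast
    have "\<not> ?s \<subseteq> support (h (t, y))"
      using supp[OF that(1) y] polyhedronD(2)[OF that(2)] by (auto simp: L_def)
    then show ?thesis using hK[OF that(1) y] by (simp add: L_def polyhedron_def)
  qed
  have h0: "h (0, y) \<in> polyhedron L" if "y \<in> ?U" for y
  proof -
    obtain v where "v \<in> ?s" "m y * x v = y v" using m_att by blast
    then have "v \<in> ?s" "v \<notin> support (h (0, y))" by (simp_all add: h_def)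
    then have "\<not> ?s \<subseteq> support (h (0, y))" by blast
    then show ?thesis using hK[of 0 y] that by (simp add: L_def polyhedron_def)
  qed
  have cont: "continuous_on ({0..1} \<times> ?U) h"
    unfolding h_def case_prod_unfold m_def
  proof (intro continuous_on_coordinatewise_then_product continuous_on_Min continuous_intros s(1,2) ballI)
    fix p :: "real \<times> ('a \<Rightarrow> real)" assume "p \<in> {0..1} \<times> ?U"
    then show "1 - (1 - fst p) * Min ((\<lambda>v. snd p v / x v) ` ?s) \<noteq> 0"
      using den[of "fst p" "snd p"] by (auto simp: m_def)
  qed auto
  have top: "subtopology (realization K) ?U = top_of_set ?U"
    by (simp add: realization_eq subtopology_subtopology Int_absorb1)
  \<comment> \<open>The deformation kills the homology of \<open>?U\<close> relative to
    \<open>L\<close>; in the exact sequence of the triple \<open>L\<close>, \<open>?U\<close>,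
    \<open>K\<close> the two other pairs then agree.\<close>
  have "trivial_group (relative_homology_group q (subtopology (realization K) ?U) (polyhedron L))" for q
    unfolding top
  proof (rule trivial_relative_homology_group_alt)
    have "continuous_on ?U (\<lambda>y. h (0, y))"
      by (rule continuous_on_compose2[OF cont]) (auto intro!: continuous_intros)
    then show "continuous_map (top_of_set ?U) (subtopology (top_of_set ?U) (polyhedron L)) (\<lambda>y. h (0, y))"
      using h0 LU by (auto simp: subtopology_subtopology Int_absorb1)
    show "homotopic_with_canon (\<lambda>k. k ` polyhedron L \<subseteq> polyhedron L) ?U ?U (\<lambda>y. h (0, y)) id"
    proof (rule homotopic_with_canonI[OF cont])
      show "(\<lambda>y. h (t, y)) ` polyhedron L \<subseteq> polyhedron L" if "t \<in> {0..1}" for t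
        using hL[OF that] by blast
    qed (use hU in \<open>auto simp: h_def\<close>)
  qed
  note triv = this
  have "hom_induced p (realization K) (polyhedron L) (realization K) ?U id \<in>
    iso (relative_homology_group p (realization K) (polyhedron L)) (relative_homology_group p (realization K) ?U)"
  proof (rule very_short_exact_sequence[OF _ triv[of p] triv[of "p - 1"]])
    show "exact_seq ([relative_homology_group (p - 1) (subtopology (realization K) ?U) (polyhedron L),
        relative_homology_group p (realization K) ?U,
        relative_homology_group p (realization K) (polyhedron L),
        relative_homology_group p (subtopology (realization K) ?U) (polyhedron L)],
       [hom_relboundary p (realization K) ?U (polyhedron L),
        hom_induced p (realization K) (polyhedron L) (realization K) ?U id,
        hom_induced p (subtopology (realization K) ?U) (polyhedron L) (realization K) (polyhedron L) id])"
      using homology_exactness_triple_1[OF LU, of p "realization K"]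
        homology_exactness_triple_3[OF LU, of p "realization K"] by fastforce
  qed
  then show ?thesis by (auto simp: is_iso_def)
qed

section \<open>Local Euler characteristics\<close>

text \<open>Summed over simplices instead of dimensions, so that removing one simplex removes one
  term.\<close>

definition face_sum :: "'v set set \<Rightarrow> int" where
  "face_sum K = (\<Sum>s\<in>K. (-1) ^ (card s - 1))"

text \<open>A finite union of closed simplices; needed for excision and for compactness.\<close>

lemma closed_polyhedron:
  assumes "finite_simplicial_complex K"
  shows "closed (polyhedron K)"
proof -
  define C where "C s = {x. (\<forall>v. 0 \<le> x v) \<and> (\<forall>v. v \<notin> s \<longrightarrow> x v = 0) \<and> (\<Sum>v\<in>s. x v) = (1::real)}" for s :: "'a set"
  have cont: "continuous_on UNIV (\<lambda>x :: 'a \<Rightarrow> real. x v)" for v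
    by simp
  have "closed (C s)" for s
    unfolding C_def
    by (intro closed_Collect_conj closed_Collect_all closed_Collect_le closed_Collect_imp
        closed_Collect_eq continuous_on_const continuous_on_sum cont) auto
  moreover have "polyhedron K = (\<Union>s\<in>K. C s)"
  proof (intro antisym subsetI)
    fix x assume x: "x \<in> polyhedron K"
    then have "x \<in> C (support x)" by (auto simp: C_def polyhedron_def)
    then show "x \<in> (\<Union>s\<in>K. C s)" using polyhedronD(2)[OF x] by blast
  next
    fix x assume "x \<in> (\<Union>s\<in>K. C s)"
    then obtain s where s: "s \<in> K" "x \<in> C s" by blast
    then show "x \<in> polyhedron K"
      by (intro polyhedronI[OF assms _ _ s(1)]) (auto simp: C_def)
  qed
  ultimately show ?thesis
    using finite_simplicial_complexD(1)[OF assms] by auto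
qed

text \<open>Everything outside the closed facet is excised. This cannot start from the polyhedron of
  \<open>K - {s}\<close>, since the closure of the excised set may contain boundary points of the
  facet that are not interior to it. Hence the detour over the complement of a point inside
  \<open>s\<close>, which is open.\<close>

lemma relative_homology_facet:
  assumes K: "finite_simplicial_complex K" and s: "s \<in> K" "\<And>t. t \<in> K \<Longrightarrow> s \<subseteq> t \<Longrightarrow> t = s"
  defines "D \<equiv> {t. t \<subseteq> s \<and> t \<noteq> {}}"
  shows "relative_homology_group p (realization D) (polyhedron (D - {s})) \<cong>
    relative_homology_group p (realization K) (polyhedron (K - {s}))"
proof -
  have DK: "D \<subseteq> K" and sD: "s \<in> D"
    using finite_simplicial_complexD(3,4)[OF K s(1)] s(1) by (auto simp: D_def)
  have D: "finite_simplicial_complex D"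
    using K DK by (rule finite_simplicial_complex_subset) (auto simp: D_def finite_simplicial_complexD(3)[OF K])
  obtain x where x: "x \<in> polyhedron D" "support x = s" using barycenter[OF D sD] .
  have xK: "x \<in> polyhedron K" using x(1) polyhedron_mono[OF DK] by blast
  let ?X = "realization K" and ?T = "polyhedron K - {x}" and ?U = "polyhedron K - polyhedron D"
  \<comment> \<open>As \<open>s\<close> is maximal, the simplices that do not contain it are all the
    others.\<close>
  have star: "{t \<in> K. \<not> s \<subseteq> t} = K - {s}" "{t \<in> D. \<not> s \<subseteq> t} = D - {s}"
    using s DK sD by blast+
  have "relative_homology_group p (realization D) (polyhedron (D - {s})) \<cong>
      relative_homology_group p (realization D) (polyhedron D - {x})"
    using relative_homology_punctured[OF D x(1), of p] by (simp only: x(2) star)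
  also have "\<dots> \<cong> relative_homology_group p ?X ?T"
  proof -
    have K0: "finite_simplicial_complex (K - {s})"
      using K by (rule finite_simplicial_complex_subset) (use s in auto)
    have U0: "?U \<subseteq> polyhedron (K - {s})"
      using sD by (auto simp: polyhedron_def)
    have T0: "polyhedron (K - {s}) \<subseteq> ?T"
      using polyhedron_mono[of "K - {s}" K] x(2) by (auto simp: polyhedron_def)
    have "closedin ?X (polyhedron (K - {s}))"
      unfolding realization_eq
      using closed_polyhedron[OF K0] polyhedron_mono[of "K - {s}" K] by (auto intro: closed_subset)
    then have "?X closure_of ?U \<subseteq> polyhedron (K - {s})"
      using U0 by (rule closure_of_minimal[rotated])
    moreover have "closed {y. \<forall>v. y v = x v}"
      by (intro closed_Collect_all closed_Collect_eq continuous_on_const continuous_on_product_coordinates)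
    then have "closed {x}" by (simp add: fun_eq_iff[symmetric])
    then have "openin ?X ?T"
      unfolding realization_eq by (simp add: openin_diff closed_subset xK)
    then have "?X interior_of ?T = ?T" by (simp add: interior_of_openin)
    ultimately have "?X closure_of ?U \<subseteq> ?X interior_of ?T" using T0 by blast
    from homology_excision_axiom[OF this, of "polyhedron K" p]
    have "relative_homology_group p (subtopology ?X (polyhedron K - ?U)) (?T - ?U) \<cong>
        relative_homology_group p (subtopology ?X (polyhedron K)) ?T"
      by (auto simp: is_iso_def)
    moreover have "polyhedron K - ?U = polyhedron D" "?T - ?U = polyhedron D - {x}"
      using polyhedron_mono[OF DK] by blast+
    ultimately show ?thesis
      using subtopology_realization[OF DK] subtopology_realization[of K K] by simp
  qed
  also have "\<dots> \<cong> relative_homology_group p ?X (polyhedron (K - {s}))"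
    using relative_homology_punctured[OF K xK, of p, unfolded x(2) star]
    by (rule group.iso_sym[OF group_relative_homology_group])
  finally show ?thesis .
qed

lemma face_sum_remove:
  "finite K \<Longrightarrow> s \<in> K \<Longrightarrow> face_sum K = face_sum (K - {s}) + (-1) ^ (card s - 1)"
  unfolding face_sum_def by (simp add: sum.remove)

lemma sum_power_card_Pow:
  assumes "finite s"
  shows "(\<Sum>u\<in>Pow s. (t :: 'a::comm_ring_1) ^ card u) = (1 + t) ^ card s"
proof -
  have "(1 + t) ^ card s = (\<Prod>v\<in>s. t + 1)" by (simp add: add.commute)
  also have "\<dots> = (\<Sum>u\<in>Pow s. (\<Prod>v\<in>u. t) * (\<Prod>v\<in>s - u. 1))"
    using assms by (rule prod_add)
  finally show ?thesis by simp
qed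

lemma face_sum_simplex:
  assumes "finite s" "s \<noteq> {}"
  shows "face_sum {t. t \<subseteq> s \<and> t \<noteq> {}} = 1"
proof -
  have eq: "Pow s = insert {} {t. t \<subseteq> s \<and> t \<noteq> {}}" by auto
  have fin: "finite {t. t \<subseteq> s \<and> t \<noteq> {}}"
    using assms(1) by simp
  have "face_sum {t. t \<subseteq> s \<and> t \<noteq> {}} = (\<Sum>t\<in>{t. t \<subseteq> s \<and> t \<noteq> {}}. - ((-1) ^ card t))"
    unfolding face_sum_def
  proof (rule sum.cong[OF refl])
    fix t assume "t \<in> {t. t \<subseteq> s \<and> t \<noteq> {}}"
    then have "card t > 0" using assms(1) finite_subset by (auto simp: card_gt_0_iff)
    then show "(-1) ^ (card t - 1) = - ((-1) ^ card t :: int)"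
      by (cases "card t") auto
  qed
  also have "\<dots> = 1"
    using sum_power_card_Pow[OF assms(1), of "- 1 :: int"] assms fin unfolding eq
    by (simp add: sum_negf power_0_left)
  finally show ?thesis .
qed

text \<open>Induction on the number of simplices, removing a facet \<open>s\<close>. Its
  contribution is that of a simplex relative to its boundary. Both of these are known, the simplex
  because it is contractible and the boundary by induction, so the homology of spheres does not
  enter.\<close>

lemma has_euler_realization:
  assumes "finite_simplicial_complex K"
  shows "has_euler (realization K) {} (face_sum K)"
  using assms
proof (induction "card K" arbitrary: K rule: less_induct)
  case less
  note K = less.prems
  note fin = finite_simplicial_complexD(1)[OF K]
  show ?case
  proof (cases "K = {}")
    case True
    then have "topspace (realization K) = {}" by (simp add: polyhedron_def)
    then show ?thesis using True by (simp add: has_euler_empty face_sum_def)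
  next
    case False
    obtain s where s: "s \<in> K" and s': "\<And>t. t \<in> K \<Longrightarrow> s \<subseteq> t \<Longrightarrow> t = s"
      using finite_has_maximal[OF fin False] by auto
    define D where "D = {t. t \<subseteq> s \<and> t \<noteq> {}}"
    note sfin = finite_simplicial_complexD(2,3)[OF K s]
    have DK: "D \<subseteq> K" and sD: "s \<in> D"
      using finite_simplicial_complexD(4)[OF K s] sfin by (auto simp: D_def)
    have D: "finite_simplicial_complex D"
      using K DK by (rule finite_simplicial_complex_subset)
        (auto simp: D_def finite_simplicial_complexD(3)[OF K])
    have eulD: "has_euler (realization D) {} (face_sum D)"
    proof -
      have "contractible_space (realization D)"
        using D sD by (rule contractible_polyhedron_simplex) (simp add: D_def)
      moreover have "topspace (realization D) \<noteq> {}"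
        using barycenter[OF D sD] by auto
      ultimately have "has_euler (realization D) {} 1"
        by (rule has_euler_contractible)
      then show ?thesis using face_sum_simplex[OF sfin] by (simp add: D_def)
    qed
    show ?thesis
    proof (cases "D = K")
      case True then show ?thesis using eulD by simp
    next
      case False
      have sub: "finite_simplicial_complex (K - {s})" "finite_simplicial_complex (D - {s})"
        by (rule finite_simplicial_complex_subset[OF K], use s' in auto)
          (rule finite_simplicial_complex_subset[OF D], auto simp: D_def)
      have "card D < card K" using DK False fin by (simp add: psubset_card_mono psubsetI)
      moreover have "card (D - {s}) \<le> card D" using finite_subset[OF DK fin] by (simp add: card_mono)
      ultimately have "has_euler (realization (D - {s})) {} (face_sum (D - {s}))"
        by (intro less.hyps sub) simp
      then have "has_euler (subtopology (realization D) (polyhedron (D - {s}))) {} (face_sum (D - {s}))"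
        by (simp add: subtopology_realization)
      then have "has_euler (realization D) (polyhedron (D - {s})) (face_sum D - face_sum (D - {s}))"
        using eulD by (rule has_euler_relative)
      then have rel: "has_euler (realization K) (polyhedron (K - {s})) (face_sum D - face_sum (D - {s}))"
        by (rule has_euler_iso) (use relative_homology_facet[OF K s s'] in \<open>simp add: D_def\<close>)
      have "has_euler (realization (K - {s})) {} (face_sum (K - {s}))"
        using s fin by (intro less.hyps sub) (rule card_Diff1_less)
      then have "has_euler (subtopology (realization K) (polyhedron (K - {s}))) {} (face_sum (K - {s}))"
        by (simp add: subtopology_realization)
      then have "has_euler (realization K) {} (face_sum (K - {s}) + (face_sum D - face_sum (D - {s})))"
        using rel by (rule has_euler_extension)
      then show ?thesis
        using face_sum_remove[OF fin s] face_sum_remove[OF finite_subset[OF DK fin] sD] by simp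
    qed
  qed
qed

section \<open>Local homology of Euclidean space and the local relations\<close>

lemma
  shows Euclidean_local_homology:
      "relative_homology_group (int n) (Euclidean_space n) (topspace (Euclidean_space n) - {\<lambda>i. 0}) \<cong> integer_group"
    and Euclidean_local_homology_trivial: "p \<noteq> int n \<Longrightarrow>
      trivial_group (relative_homology_group p (Euclidean_space n) (topspace (Euclidean_space n) - {\<lambda>i. 0}))"
proof -
  have top: "topspace (Euclidean_space 0) = {\<lambda>i. 0}"
    by (auto simp: topspace_Euclidean_space)
  \<comment> \<open>\<open>Euclidean_space 0\<close> is a point; each added dimension raises the
    degree by one.\<close>
  have iso: "homology_group q (Euclidean_space 0) \<cong>
      relative_homology_group (q + int n) (Euclidean_space n) (topspace (Euclidean_space n) - {\<lambda>i. 0})" for q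
    using relative_homology_group_Euclidean_complement_step[of 0 "{\<lambda>i. 0}" q n]
      closedin_topspace[of "Euclidean_space 0"] by (simp add: top)
  show "relative_homology_group (int n) (Euclidean_space n) (topspace (Euclidean_space n) - {\<lambda>i. 0}) \<cong> integer_group"
    using group.iso_sym[OF _ iso[of 0]] homology_coefficients[OF top] iso_trans by fastforce
  show "trivial_group (relative_homology_group p (Euclidean_space n) (topspace (Euclidean_space n) - {\<lambda>i. 0}))"
    if "p \<noteq> int n"
    using isomorphic_group_triviality[OF iso[of "p - int n"]] homology_dimension_axiom[OF top, of "p - int n"] that
    by simp
qed

lemma homology_manifold_local_euler:
  assumes "compact_triangulated_homology_manifold n K" "s \<in> K"
  shows "(\<Sum>t | t \<in> K \<and> s \<subseteq> t. (-1) ^ (card t - 1)) = ((-1) ^ n :: int)"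
proof -
  have K: "finite_simplicial_complex K" and man: "homology_manifold n (realization K)"
    using assms(1) by (auto simp: compact_triangulated_homology_manifold_def)
  note fin = finite_simplicial_complexD(1)[OF K]
  obtain x where x: "x \<in> polyhedron K" "support x = s" using barycenter[OF K assms(2)] .
  define L where "L = {t \<in> K. \<not> s \<subseteq> t}"
  have L: "finite_simplicial_complex L"
    using K by (rule finite_simplicial_complex_subset) (auto simp: L_def)
  have LK: "L \<subseteq> K" by (auto simp: L_def)
  have "has_euler (realization K) (polyhedron L) (face_sum K - face_sum L)"
    using has_euler_realization[OF L] has_euler_realization[OF K] subtopology_realization[OF LK]
    by (intro has_euler_relative) simp_all
  then have "has_euler (realization K) (polyhedron K - {x}) (face_sum K - face_sum L)"
    by (rule has_euler_iso) (use relative_homology_punctured[OF K x(1)] in \<open>simp only: x(2) L_def\<close>)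
  then have "has_euler (Euclidean_space n) (topspace (Euclidean_space n) - {\<lambda>i. 0}) (face_sum K - face_sum L)"
    by (rule has_euler_iso) (use man x(1) in \<open>simp add: homology_manifold_def\<close>)
  moreover have "has_euler (Euclidean_space n) (topspace (Euclidean_space n) - {\<lambda>i. 0}) ((-1) ^ n)"
    using Euclidean_local_homology Euclidean_local_homology_trivial by (rule has_euler_like_sphere)
  ultimately have "face_sum K - face_sum L = (-1) ^ n" by (rule has_euler_unique)
  moreover have "face_sum K = face_sum L + (\<Sum>t | t \<in> K \<and> s \<subseteq> t. (-1) ^ (card t - 1))"
  proof -
    have "K = L \<union> {t. t \<in> K \<and> s \<subseteq> t}" "L \<inter> {t. t \<in> K \<and> s \<subseteq> t} = {}" by (auto simp: L_def)
    then show ?thesis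
      unfolding face_sum_def using fin LK
      by (metis (no_types, lifting) finite_Un sum.union_disjoint)
  qed
  ultimately show ?thesis by simp
qed

section \<open>Face polynomials\<close>

text \<open>Passage from sums over dimensions to sums over simplices, for powers of \<open>t\<close>
  as well as for signs. Simplices are nonempty, so the truncated \<open>card s - 1\<close> loses
  nothing.\<close>

lemma sum_simplices:
  fixes h :: "nat \<Rightarrow> 'a::comm_ring_1"
  assumes "finite_simplicial_complex K"
  shows "(\<Sum>p\<le>complex_dim K. of_nat (face_number p K) * h p) = (\<Sum>s\<in>K. h (card s - 1))"
proof -
  note fin = finite_simplicial_complexD(1)[OF assms]
  have dim: "(\<lambda>s. card s - 1) ` K \<subseteq> {..complex_dim K}"
    unfolding complex_dim_def using fin by (auto intro!: cSUP_upper bdd_above_finite)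
  have "card s = p + 1 \<longleftrightarrow> card s - 1 = p" if "s \<in> K" for s p
    using finite_simplicial_complexD(2,3)[OF assms that] by (cases "card s") auto
  then have "simplices p K = {s \<in> K. card s - 1 = p}" for p
    by (auto simp: simplices_def)
  then have "of_nat (face_number p K) * h p = (\<Sum>s | s \<in> K \<and> card s - 1 = p. h (card s - 1))" for p
    by (simp add: face_number_def)
  then show ?thesis
    using sum.group[OF fin finite_atMost dim, of "\<lambda>s. h (card s - 1)"] by simp
qed

lemma poly_face_poly:
  assumes "finite_simplicial_complex K"
  shows "poly (face_poly K) (t :: 'a::comm_ring_1) = (\<Sum>s\<in>K. t ^ (card s - 1))"
  using sum_simplices[OF assms, of "\<lambda>p. t ^ p"]
  by (simp add: face_poly_def poly_sum poly_monom)

lemma euler_char_eq_face_sum: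
  assumes "finite_simplicial_complex K"
  shows "euler_char K = face_sum K"
  using sum_simplices[OF assms, of "\<lambda>p. (-1 :: int) ^ p"]
  by (simp add: euler_char_def face_sum_def mult.commute)

lemma poly_face_poly_minus_one:
  assumes "finite_simplicial_complex K"
  shows "poly (face_poly K) (- 1 :: 'a::comm_ring_1) = of_int (euler_char K)"
  by (simp add: poly_face_poly[OF assms] euler_char_eq_face_sum[OF assms] face_sum_def)

text \<open>The factor \<open>t\<close> shifts exponents from dimensions to cardinalities, for which
  subsets are counted by the binomial theorem.\<close>

lemma mult_poly_face_poly:
  assumes "finite_simplicial_complex K"
  shows "t * poly (face_poly K) (t :: 'a::comm_ring_1) = (\<Sum>s\<in>K. t ^ card s)"
  unfolding poly_face_poly[OF assms] sum_distrib_left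
proof (rule sum.cong[OF refl])
  fix s assume "s \<in> K"
  then have "card s > 0"
    using finite_simplicial_complexD(2,3)[OF assms] by (simp add: card_gt_0_iff)
  then show "t * t ^ (card s - 1) = t ^ card s"
    by (cases "card s") auto
qed

text \<open>Dehn--Sommerville: expand \<open>(1 + t)\<^sup>|\<^sup>s\<^sup>|\<close> over the faces of \<open>s\<close> and exchange the sums.\<close>

lemma face_poly_reflection:
  fixes t :: "'a::comm_ring_1"
  assumes "compact_triangulated_homology_manifold n K"
  shows "(- 1 - t) * poly (face_poly K) (- 1 - t) =
    - of_int (euler_char K) - (-1) ^ n * (t * poly (face_poly K) t)"
proof -
  have K: "finite_simplicial_complex K"
    using assms by (simp add: compact_triangulated_homology_manifold_def)
  note fin = finite_simplicial_complexD(1)[OF K]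
  have sgn: "(-1) ^ card s = - ((-1) ^ (card s - 1) :: 'a)" if "s \<in> K" for s
    using finite_simplicial_complexD(2,3)[OF K that] by (cases "card s") auto
  have local: "(\<Sum>s | s \<in> K \<and> u \<subseteq> s. (-1) ^ card s) = - ((-1) ^ n :: 'a)" if "u \<in> K" for u
  proof -
    have "(\<Sum>s | s \<in> K \<and> u \<subseteq> s. (-1) ^ card s) = (\<Sum>s | s \<in> K \<and> u \<subseteq> s. - ((-1) ^ (card s - 1) :: 'a))"
      by (rule sum.cong) (auto simp: sgn)
    also have "\<dots> = - of_int (\<Sum>s | s \<in> K \<and> u \<subseteq> s. (-1) ^ (card s - 1))"
      by (simp add: sum_negf)
    also have "\<dots> = - ((-1) ^ n)"
      by (simp only: homology_manifold_local_euler[OF assms that]) simp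
    finally show ?thesis .
  qed
  \<comment> \<open>The summand 1 belongs to the empty set, which is not a simplex; it produces the
    term with the Euler characteristic.\<close>
  have expand: "(1 + t) ^ card s = 1 + (\<Sum>u | u \<in> K \<and> u \<subseteq> s. t ^ card u)" if "s \<in> K" for s
  proof -
    note sfin = finite_simplicial_complexD(2)[OF K that]
    have "Pow s = insert {} {u. u \<in> K \<and> u \<subseteq> s}"
      using finite_simplicial_complexD(4)[OF K that] by blast
    moreover have "{} \<notin> {u. u \<in> K \<and> u \<subseteq> s}" "finite {u. u \<in> K \<and> u \<subseteq> s}"
      using finite_simplicial_complexD(3)[OF K] fin by auto
    ultimately show ?thesis
      using sum_power_card_Pow[OF sfin, of t] by simp
  qed
  have "(- 1 - t) * poly (face_poly K) (- 1 - t) = (\<Sum>s\<in>K. (- 1 - t) ^ card s)"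
    by (rule mult_poly_face_poly[OF K])
  also have "\<dots> = (\<Sum>s\<in>K. (-1) ^ card s * (1 + t) ^ card s)"
    unfolding power_mult_distrib[symmetric] by simp
  also have "\<dots> = (\<Sum>s\<in>K. (-1) ^ card s + (\<Sum>u | u \<in> K \<and> u \<subseteq> s. (-1) ^ card s * t ^ card u))"
    by (rule sum.cong[OF refl]) (simp only: expand distrib_left mult_1_right sum_distrib_left)
  also have "\<dots> = (\<Sum>s\<in>K. (-1) ^ card s) + (\<Sum>u\<in>K. \<Sum>s | s \<in> K \<and> u \<subseteq> s. (-1) ^ card s * t ^ card u)"
    unfolding sum.distrib by (subst sum.swap_restrict[OF fin fin]) (rule refl)
  also have "(\<Sum>s\<in>K. (-1) ^ card s) = - (of_int (euler_char K) :: 'a)"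
    unfolding euler_char_eq_face_sum[OF K] face_sum_def of_int_sum sum_negf[symmetric]
    by (rule sum.cong) (simp_all add: sgn)
  also have "(\<Sum>u\<in>K. \<Sum>s | s \<in> K \<and> u \<subseteq> s. (-1) ^ card s * t ^ card u) = (\<Sum>u\<in>K. - ((-1) ^ n) * t ^ card u)"
    by (rule sum.cong) (simp_all add: local flip: sum_distrib_right)
  also have "\<dots> = - ((-1) ^ n) * (t * poly (face_poly K) t)"
    by (simp only: mult_poly_face_poly[OF K] sum_distrib_left)
  finally show ?thesis by simp
qed

text \<open>With q for the value at the fixed point and \<open>n\<close> even, the reflection reads
  -q/2 = -chi + q/2.\<close>

lemma face_poly_minus_half:
  fixes K :: "'v set set"
  assumes "compact_triangulated_homology_manifold n K" "even n"
  shows "poly (face_poly K) (- 1 / 2 :: 'a::field_char_0) = of_int (euler_char K)"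
  using face_poly_reflection[OF assms(1), of "- 1 / 2 :: 'a"] assms(2)
  by (simp add: field_simps)

section \<open>Spheres\<close>

lemma is_iso_trivial_groups:
  assumes "group G" "group H" "trivial_group G" "trivial_group H"
  shows "G \<cong> H"
proof -
  have "(\<lambda>_. \<one>\<^bsub>H\<^esub>) \<in> iso G H"
    using assms by (auto simp: iso_def hom_def bij_betw_def trivial_group_def group.is_monoid)
  then show ?thesis by (rule is_isoI)
qed

lemma nsphere_eq_top_of_set: "nsphere n = top_of_set {x. (\<Sum>i\<le>n. x i ^ 2) = 1 \<and> (\<forall>i>n. x i = 0)}"
  by (simp add: nsphere euclidean_product_topology)

text \<open>Away from \<open>x\<close>, the straight line to \<open>-x\<close> avoids the origin, so it can be projected to the sphere.\<close>

lemma contractible_punctured_nsphere: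
  assumes "x \<in> topspace (nsphere n)"
  shows "contractible_space (subtopology (nsphere n) (topspace (nsphere n) - {x}))"
proof -
  define S where "S = {x :: nat \<Rightarrow> real. (\<Sum>i\<le>n. x i ^ 2) = 1 \<and> (\<forall>i>n. x i = 0)}"
  have xS: "x \<in> S" using assms by (simp add: nsphere_eq_top_of_set S_def)
  have top: "subtopology (nsphere n) (topspace (nsphere n) - {x}) = top_of_set (S - {x})"
    by (simp add: nsphere_eq_top_of_set S_def subtopology_subtopology Int_absorb1)
  define z where "z t y i = (1 - t) * y i - t * x i" for t :: real and y :: "nat \<Rightarrow> real" and i
  define N where "N t y = sqrt (\<Sum>i\<le>n. (z t y i)\<^sup>2)" for t y
  define h where "h = (\<lambda>(t, y) i. z t y i / N t y)"
  have sq: "(\<Sum>i\<le>n. (x i)\<^sup>2) = 1" using xS by (simp add: S_def)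
  \<comment> \<open>Unit vectors with a nontrivial nonnegative proportion coincide. This is used
    twice: the line avoids the origin, and its projection avoids \<open>x\<close>.\<close>
  have scaled: "y = x" if y: "y \<in> S" and eq: "\<And>i. i \<le> n \<Longrightarrow> a * y i = b * x i" "a \<ge> 0" "b \<ge> 0" "a + b > 0" for y a b
  proof -
    have "a\<^sup>2 = (\<Sum>i\<le>n. (a * y i)\<^sup>2)" using y by (simp add: S_def power_mult_distrib flip: sum_distrib_left)
    also have "\<dots> = (\<Sum>i\<le>n. (b * x i)\<^sup>2)" using eq(1) by simp
    also have "\<dots> = b\<^sup>2" using sq by (simp add: power_mult_distrib flip: sum_distrib_left)
    finally have "a = b" using eq by (simp add: power2_eq_iff_nonneg)
    then have "y i = x i" for i
      using eq(1)[of i] eq(4) y xS by (cases "i \<le> n") (auto simp: S_def)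
    then show "y = x" by auto
  qed
  have Npos: "N t y > 0" if "t \<in> {0..1}" "y \<in> S - {x}" for t y
  proof (rule ccontr)
    assume "\<not> N t y > 0"
    moreover have "N t y \<ge> 0" by (simp add: N_def sum_nonneg)
    ultimately have "(\<Sum>i\<le>n. (z t y i)\<^sup>2) = 0" by (simp add: N_def)
    then have "\<forall>i\<in>{..n}. (z t y i)\<^sup>2 = 0" by (subst (asm) sum_nonneg_eq_0_iff) auto
    then have "(1 - t) * y i = t * x i" if "i \<le> n" for i
      using that by (simp add: z_def)
    then have "y = x" using that by (intro scaled[of y "1 - t" t]) auto
    then show False using that by simp
  qed
  have hS: "h (t, y) \<in> S - {x}" if "t \<in> {0..1}" "y \<in> S - {x}" for t y
  proof -
    have N2: "(\<Sum>i\<le>n. (z t y i)\<^sup>2) = (N t y)\<^sup>2" by (simp add: N_def sum_nonneg)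
    have "(\<Sum>i\<le>n. (h (t, y) i)\<^sup>2) = 1"
      using Npos[OF that] N2 by (simp add: h_def power_divide flip: sum_divide_distrib)
    moreover have "h (t, y) i = 0" if "i > n" for i
      using that \<open>y \<in> S - {x}\<close> xS by (simp add: h_def z_def S_def)
    ultimately have "h (t, y) \<in> S" by (simp add: S_def)
    moreover have "h (t, y) \<noteq> x"
    proof
      assume *: "h (t, y) = x"
      have "(1 - t) * y i = (t + N t y) * x i" for i
      proof -
        have "z t y i / N t y = x i" using fun_cong[OF *, of i] by (simp add: h_def)
        then have "z t y i = x i * N t y" using Npos[OF that] by (simp add: field_simps)
        then show ?thesis by (simp add: z_def algebra_simps)
      qed
      then have "y = x" using that Npos[OF that] by (intro scaled[of y "1 - t" "t + N t y"]) auto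
      then show False using that by simp
    qed
    ultimately show ?thesis by simp
  qed
  have cont: "continuous_on ({0..1} \<times> (S - {x})) h"
    unfolding h_def case_prod_unfold N_def z_def
  proof (intro continuous_on_coordinatewise_then_product continuous_intros ballI)
    fix p :: "real \<times> (nat \<Rightarrow> real)" assume "p \<in> {0..1} \<times> (S - {x})"
    then show "sqrt (\<Sum>i\<le>n. ((1 - fst p) * snd p i - fst p * x i)\<^sup>2) \<noteq> 0"
      using Npos[of "fst p" "snd p"] by (auto simp: N_def z_def)
  qed
  have "homotopic_with_canon (\<lambda>_. True) (S - {x}) (S - {x}) (\<lambda>y. h (0, y)) (\<lambda>y. h (1, y))"
    using cont hS by (rule homotopic_with_canonI) auto
  then have "homotopic_with_canon (\<lambda>_. True) (S - {x}) (S - {x}) id (\<lambda>_ i. - x i)"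
    by (rule homotopic_with_eq) (use sq in \<open>auto simp: h_def N_def z_def S_def\<close>)
  then show ?thesis unfolding contractible_space_def top by (rule exI[of _ "\<lambda>i. - x i"])
qed

text \<open>The complement of a point is contractible, so the local homology is the reduced homology
  of the sphere, which agrees with that of the Euclidean pair in each degree.\<close>

lemma homology_manifold_nsphere: "homology_manifold n (nsphere n)"
  unfolding homology_manifold_def
proof (intro ballI allI)
  fix x p assume x: "x \<in> topspace (nsphere n)"
  let ?S = "topspace (nsphere n) - {x}"
  let ?E = "relative_homology_group p (Euclidean_space n) (topspace (Euclidean_space n) - {\<lambda>i. 0})"
  \<comment> \<open>The antipode keeps the punctured sphere nonempty, also for the two points in
    dimension 0.\<close>
  have "(\<lambda>i. - x i) \<in> ?S"
  proof -
    have "(\<lambda>i. - x i) \<noteq> x"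
    proof
      assume *: "(\<lambda>i. - x i) = x"
      have "x i = 0" for i using fun_cong[OF *, of i] by simp
      then show False using x by (simp add: nsphere_eq_top_of_set)
    qed
    then show ?thesis using x by (simp add: nsphere_eq_top_of_set)
  qed
  then have ne: "topspace (nsphere n) \<inter> ?S \<noteq> {}" by blast
  have iso: "relative_homology_group p (nsphere n) ?S \<cong> reduced_homology_group p (nsphere n)"
    using contractible_punctured_nsphere[OF x] ne by (rule isomorphic_relative_homology_by_contractible)
  show "relative_homology_group p (nsphere n) ?S \<cong> ?E"
  proof (cases "p = int n")
    case True
    have "relative_homology_group p (nsphere n) ?S \<cong> integer_group"
      using iso reduced_homology_group_nsphere(1)[of n] iso_trans unfolding True by blast
    moreover have "integer_group \<cong> ?E"
      unfolding True using Euclidean_local_homology by (rule group.iso_sym[rotated]) simp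
    ultimately show ?thesis by (rule iso_trans)
  next
    case False
    have "reduced_homology_group p (nsphere n) \<cong> ?E"
      using reduced_homology_group_nsphere(2)[OF False] Euclidean_local_homology_trivial[OF False]
      by (intro is_iso_trivial_groups) simp_all
    with iso show ?thesis by (rule iso_trans)
  qed
qed

lemma homology_manifold_homeomorphic_map:
  assumes f: "homeomorphic_map X Y f" and "homology_manifold n Y"
  shows "homology_manifold n X"
  unfolding homology_manifold_def
proof (intro ballI allI)
  fix x p assume x: "x \<in> topspace X"
  have im: "f ` topspace X = topspace Y" and inj: "inj_on f (topspace X)"
    using f by (auto simp: homeomorphic_eq_everything_map)
  have "f ` (topspace X - {x}) = topspace Y - {f x}"
    using im inj x by (auto simp: inj_on_def)
  then have "relative_homology_group p X (topspace X - {x}) \<cong> relative_homology_group p Y (topspace Y - {f x})"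
    by (intro is_isoI[OF homeomorphic_map_relative_homology_iso[OF f]]) auto
  also have "\<dots> \<cong> relative_homology_group p (Euclidean_space n) (topspace (Euclidean_space n) - {\<lambda>i. 0})"
    using assms(2) x im by (auto simp: homology_manifold_def)
  finally show "relative_homology_group p X (topspace X - {x}) \<cong>
    relative_homology_group p (Euclidean_space n) (topspace (Euclidean_space n) - {\<lambda>i. 0})" .
qed

text \<open>A closed subset of a cube, which is compact by Tychonoff's theorem even over infinitely
  many vertices.\<close>

lemma compact_polyhedron:
  assumes "finite_simplicial_complex K"
  shows "compact_space (realization K)"
proof -
  have "compactin (powertop_real UNIV) (PiE UNIV (\<lambda>_. {0..1}))"
    by (simp add: compactin_PiE)
  moreover have "polyhedron K \<subseteq> PiE UNIV (\<lambda>_. {0..1})"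
  proof
    fix x assume x: "x \<in> polyhedron K"
    have "x v \<le> 1" for v
    proof (cases "x v = 0")
      case False
      have "x v \<le> (\<Sum>v\<in>support x. x v)"
        using False finite_simplicial_complexD(2)[OF assms polyhedronD(2)[OF x]] polyhedronD(1)[OF x]
        by (intro member_le_sum) auto
      then show ?thesis by (simp add: polyhedronD(3)[OF x])
    qed simp
    then show "x \<in> PiE UNIV (\<lambda>_. {0..1})" using polyhedronD(1)[OF x] by auto
  qed
  ultimately have "compact (polyhedron K)"
    using closed_compactin[of "powertop_real UNIV" "PiE UNIV (\<lambda>_. {0..1})" "polyhedron K"]
      closed_polyhedron[OF assms] by (simp add: euclidean_product_topology)
  then show ?thesis by (simp add: realization_eq compact_space_subtopology)
qed

section \<open>Joins of boundaries of simplices\<close>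

text \<open>The blocks are the vertex sets of the joined simplices. Each has one distinguished vertex
  \<open>Suc n + j\<close>; the other vertices are numbered by the coordinates \<open>0, \<dots>, n\<close> of the ambient space
  of the sphere.\<close>

definition join_block :: "nat \<Rightarrow> (nat \<Rightarrow> nat) \<Rightarrow> nat \<Rightarrow> nat set" where
  "join_block n \<beta> j = insert (Suc n + j) {v. v \<le> n \<and> \<beta> v = j}"

text \<open>Only values of \<open>\<beta>\<close> count as blocks, so each block has at least two
  vertices. A maximal simplex omits one vertex of every block and thus has \<open>n + 1\<close>
  vertices, whatever \<open>\<beta>\<close> is.\<close>

definition join_complex :: "nat \<Rightarrow> (nat \<Rightarrow> nat) \<Rightarrow> nat set set" where
  "join_complex n \<beta> = {s. s \<noteq> {} \<and> s \<subseteq> (\<Union>j\<in>\<beta> ` {..n}. join_block n \<beta> j) \<and>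
     (\<forall>j\<in>\<beta> ` {..n}. \<not> join_block n \<beta> j \<subseteq> s)}"

text \<open>Coordinates are taken modulo a constant on each block, with the distinguished vertex
  normalised to 0. Every class contains exactly one nonnegative vector with a zero in each
  block.\<close>

definition join_chart :: "nat \<Rightarrow> (nat \<Rightarrow> nat) \<Rightarrow> (nat \<Rightarrow> real) \<Rightarrow> nat \<Rightarrow> real" where
  "join_chart n \<beta> x i = (if i \<le> n then x i - x (Suc n + \<beta> i) else 0)"

lemma finite_join_block: "finite (join_block n \<beta> j)"
  by (simp add: join_block_def)

lemma finite_simplicial_complex_join: "finite_simplicial_complex (join_complex n \<beta>)"
proof -
  let ?V = "\<Union>j\<in>\<beta> ` {..n}. join_block n \<beta> j"
  have V: "finite ?V" by (simp add: finite_join_block)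
  have sub: "join_complex n \<beta> \<subseteq> Pow ?V" by (auto simp: join_complex_def)
  have "finite (join_complex n \<beta>)" using sub V finite_subset by blast
  moreover have "finite s \<and> s \<noteq> {}" if "s \<in> join_complex n \<beta>" for s
    using that V finite_subset unfolding join_complex_def by blast
  moreover have "t \<in> join_complex n \<beta>" if "s \<in> join_complex n \<beta>" "t \<subseteq> s" "t \<noteq> {}" for s t
    using that unfolding join_complex_def by blast
  ultimately show ?thesis unfolding finite_simplicial_complex_def by blast
qed

text \<open>On a block, \<open>x'\<close> and \<open>c * x\<close> differ by a constant
  \<open>d\<close>. Both are nonnegative and vanish somewhere on the block, so \<open>d = 0\<close>.
  The case \<open>c = 0\<close> shows that the chart avoids the origin.\<close>

lemma join_chart_proportional:
  assumes x: "x \<in> polyhedron (join_complex n \<beta>)" and x': "x' \<in> polyhedron (join_complex n \<beta>)"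
    and "c \<ge> 0" and eq: "\<And>i. i \<le> n \<Longrightarrow> join_chart n \<beta> x' i = c * join_chart n \<beta> x i"
  shows "x' v = c * x v"
proof (cases "v \<in> (\<Union>j\<in>\<beta> ` {..n}. join_block n \<beta> j)")
  case True
  then obtain j where j: "j \<in> \<beta> ` {..n}" "v \<in> join_block n \<beta> j" by blast
  define d where "d = x' (Suc n + j) - c * x (Suc n + j)"
  have d: "x' u - c * x u = d" if "u \<in> join_block n \<beta> j" for u
  proof (cases "u = Suc n + j")
    case False
    then have "u \<le> n" "\<beta> u = j" using that by (auto simp: join_block_def)
    then show ?thesis using eq[of u] by (simp add: join_chart_def d_def algebra_simps)
  qed (simp add: d_def)
  have "\<not> join_block n \<beta> j \<subseteq> support x" "\<not> join_block n \<beta> j \<subseteq> support x'"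
    using polyhedronD(2)[OF x] polyhedronD(2)[OF x'] j(1) by (auto simp: join_complex_def)
  then obtain u u' where u: "u \<in> join_block n \<beta> j" "x u = 0" and u': "u' \<in> join_block n \<beta> j" "x' u' = 0"
    by blast
  have "d \<ge> 0" using d[OF u(1)] u(2) polyhedronD(1)[OF x', of u] by simp
  moreover have "d \<le> 0"
  proof -
    have "c * x u' \<ge> 0" using \<open>c \<ge> 0\<close> polyhedronD(1)[OF x, of u'] by simp
    then show ?thesis using d[OF u'(1)] u'(2) by simp
  qed
  ultimately show ?thesis using d[OF j(2)] by simp
next
  case False
  then have "v \<notin> support x" "v \<notin> support x'"
    using polyhedronD(2)[OF x] polyhedronD(2)[OF x'] unfolding join_complex_def by blast+
  then show ?thesis by simp
qed

text \<open>The smallest shift of a block that makes all its coordinates nonnegative also makes one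
  of them zero. \<open>m j\<close> is this shift, and the 0 in its maximum stands for the
  distinguished vertex.\<close>

lemma join_chart_surj:
  assumes nz: "\<exists>i\<le>n. y i \<noteq> 0"
  obtains x r where "x \<in> polyhedron (join_complex n \<beta>)" "r > 0"
    "\<And>i. i \<le> n \<Longrightarrow> join_chart n \<beta> x i = y i / r"
proof -
  let ?J = "\<beta> ` {..n}" and ?F = "\<lambda>j. insert 0 ((\<lambda>v. - y v) ` {v. v \<le> n \<and> \<beta> v = j})"
  define m where "m j = Max (?F j)" for j
  have fin: "finite (?F j)" for j by simp
  have m0: "m j \<ge> 0" for j unfolding m_def using fin by (intro Max_ge) auto
  have my: "m (\<beta> v) \<ge> - y v" if "v \<le> n" for v
    unfolding m_def using fin that by (intro Max_ge) auto
  have matt: "m j = 0 \<or> (\<exists>v\<le>n. \<beta> v = j \<and> m j = - y v)" for j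
  proof -
    have "m j \<in> ?F j" unfolding m_def using fin by (intro Max_in) auto
    then show ?thesis by auto
  qed
  define z where "z v = (if v \<le> n then y v + m (\<beta> v) else if v - Suc n \<in> ?J then m (v - Suc n) else 0)" for v
  have z0: "z v \<ge> 0" for v using m0[of "v - Suc n"] my[of v] by (auto simp: z_def)
  have chart: "join_chart n \<beta> z i = y i" if "i \<le> n" for i
    using that by (simp add: join_chart_def z_def)
  have "support z \<noteq> {}"
  proof
    assume "support z = {}"
    then have "z v = 0" for v by blast
    then have "y i = 0" if "i \<le> n" for i using chart[OF that] that by (simp add: join_chart_def)
    then show False using nz by blast
  qed
  moreover have "v \<in> (\<Union>j\<in>?J. join_block n \<beta> j)" if "z v \<noteq> 0" for v
  proof (cases "v \<le> n")
    case True
    then show ?thesis by (intro UN_I[of "\<beta> v"]) (auto simp: join_block_def)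
  next
    case False
    then have "v - Suc n \<in> ?J" using that by (auto simp: z_def split: if_splits)
    then show ?thesis using False by (intro UN_I[of "v - Suc n"]) (auto simp: join_block_def)
  qed
  moreover have "\<not> join_block n \<beta> j \<subseteq> support z" if "j \<in> ?J" for j
  proof -
    have "\<exists>v\<in>join_block n \<beta> j. z v = 0"
      using matt[of j]
    proof
      assume "m j = 0"
      then show ?thesis using that by (intro bexI[of _ "Suc n + j"]) (auto simp: z_def join_block_def)
    next
      assume "\<exists>v\<le>n. \<beta> v = j \<and> m j = - y v"
      then obtain v where "v \<le> n" "\<beta> v = j" "m j = - y v" by blast
      then show ?thesis by (intro bexI[of _ v]) (auto simp: z_def join_block_def)
    qed
    then show ?thesis by blast
  qed
  ultimately have K: "support z \<in> join_complex n \<beta>"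
    unfolding join_complex_def by blast
  note D = finite_simplicial_complexD(2,3)[OF finite_simplicial_complex_join K]
  define r where "r = (\<Sum>v\<in>support z. z v)"
  have "r > 0" unfolding r_def using D z0 by (intro sum_pos) (auto simp: less_le)
  define x where "x v = z v / r" for v
  have supp: "support x = support z" using \<open>r > 0\<close> by (simp add: x_def)
  have "x \<in> polyhedron (join_complex n \<beta>)"
    unfolding polyhedron_def mem_Collect_eq supp
    using K z0 \<open>r > 0\<close> by (simp add: x_def r_def flip: sum_divide_distrib)
  moreover have "join_chart n \<beta> x i = y i / r" if "i \<le> n" for i
    using chart[OF that] that by (simp add: join_chart_def x_def flip: diff_divide_distrib)
  ultimately show thesis using \<open>r > 0\<close> that by blast
qed

text \<open>The chart followed by radial projection is a continuous bijection from a compact space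
  to a Hausdorff space.\<close>

lemma homeomorphic_map_join_nsphere:
  obtains f where "homeomorphic_map (realization (join_complex n \<beta>)) (nsphere n) f"
proof -
  let ?K = "join_complex n \<beta>" and ?S = "{x :: nat \<Rightarrow> real. (\<Sum>i\<le>n. x i ^ 2) = 1 \<and> (\<forall>i>n. x i = 0)}"
  define N where "N x = sqrt (\<Sum>i\<le>n. (join_chart n \<beta> x i)\<^sup>2)" for x
  define f where "f x i = join_chart n \<beta> x i / N x" for x i
  have N2: "(N x)\<^sup>2 = (\<Sum>i\<le>n. (join_chart n \<beta> x i)\<^sup>2)" for x by (simp add: N_def sum_nonneg)
  have Npos: "N x > 0" if x: "x \<in> polyhedron ?K" for x
  proof (rule ccontr)
    assume "\<not> N x > 0"
    moreover have "N x \<ge> 0" by (simp add: N_def sum_nonneg)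
    ultimately have "(\<Sum>i\<le>n. (join_chart n \<beta> x i)\<^sup>2) = 0" by (simp add: N_def)
    then have "\<forall>i\<in>{..n}. (join_chart n \<beta> x i)\<^sup>2 = 0" by (subst (asm) sum_nonneg_eq_0_iff) auto
    then have "x v = 0 * x v" for v by (intro join_chart_proportional[OF x x]) auto
    then have "support x = {}" by simp
    then show False using polyhedronD(3)[OF x] by simp
  qed
  have fS: "f x \<in> ?S" if "x \<in> polyhedron ?K" for x
  proof -
    have "(\<Sum>i\<le>n. (f x i)\<^sup>2) = 1"
      using Npos[OF that] by (simp add: f_def power_divide flip: sum_divide_distrib N2)
    then show ?thesis by (simp add: f_def join_chart_def)
  qed
  have coord: "continuous_on (polyhedron ?K) (\<lambda>x. x v)" for v
    by (rule continuous_on_subset[OF continuous_on_product_coordinates]) simp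
  have chart: "continuous_on (polyhedron ?K) (\<lambda>x. join_chart n \<beta> x i)" for i
    unfolding join_chart_def by (cases "i \<le> n") (simp_all add: coord continuous_on_diff)
  have "continuous_on (polyhedron ?K) f"
    unfolding f_def
  proof (rule continuous_on_coordinatewise_then_product)
    show "continuous_on (polyhedron ?K) (\<lambda>x. join_chart n \<beta> x i / N x)" for i
      unfolding N_def using Npos
      by (intro continuous_on_divide continuous_on_real_sqrt continuous_on_sum continuous_on_power chart)
        (force simp: N_def)
  qed
  then have cont: "continuous_map (realization ?K) (nsphere n) f"
    unfolding realization_eq nsphere_eq_top_of_set using fS by (auto simp: continuous_map_in_subtopology)
  have inj: "inj_on f (polyhedron ?K)"
  proof (rule inj_onI)
    fix x x' assume x: "x \<in> polyhedron ?K" and x': "x' \<in> polyhedron ?K" and "f x = f x'"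
    \<comment> \<open>Equal projections mean proportional charts; the points are then proportional
      too, and coordinate sums 1 make the factor 1.\<close>
    have eq: "x' v = (N x' / N x) * x v" for v
    proof (rule join_chart_proportional[OF x x'])
      show "N x' / N x \<ge> 0" using Npos[OF x] Npos[OF x'] by simp
      show "join_chart n \<beta> x' i = (N x' / N x) * join_chart n \<beta> x i" for i
        using fun_cong[OF \<open>f x = f x'\<close>, of i] Npos[OF x] Npos[OF x'] by (simp add: f_def field_simps)
    qed
    have "(\<Sum>v\<in>\<Union>?K. x' v) = (N x' / N x) * (\<Sum>v\<in>\<Union>?K. x v)"
      unfolding sum_distrib_left by (rule sum.cong[OF refl eq])
    then have "N x' / N x = 1"
      using polyhedron_sum[OF finite_simplicial_complex_join x] polyhedron_sum[OF finite_simplicial_complex_join x']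
      by simp
    then show "x = x'" using eq by (simp add: fun_eq_iff)
  qed
  have "f ` polyhedron ?K = ?S"
  proof (intro antisym subsetI)
    fix y assume y: "y \<in> ?S"
    have "\<exists>i\<le>n. y i \<noteq> 0"
    proof (rule ccontr)
      assume "\<not> (\<exists>i\<le>n. y i \<noteq> 0)"
      then have "(\<Sum>i\<le>n. (y i)\<^sup>2) = 0" by simp
      then show False using y by simp
    qed
    from join_chart_surj[OF this, of \<beta>]
    obtain x r where x: "x \<in> polyhedron ?K" "r > 0" "\<And>i. i \<le> n \<Longrightarrow> join_chart n \<beta> x i = y i / r"
      by metis
    have "(N x)\<^sup>2 = (1 / r)\<^sup>2"
      using y x(3) by (simp add: N2 power_divide flip: sum_divide_distrib)
    then have "N x = 1 / r" using Npos[OF x(1)] x(2) by (simp add: power2_eq_iff_nonneg)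
    then have "f x i = y i" for i
      using x(2,3) y by (cases "i \<le> n") (auto simp: f_def join_chart_def)
    then have "f x = y" by auto
    then show "y \<in> f ` polyhedron ?K" using x(1) by blast
  qed (use fS in blast)
  moreover have "Hausdorff_space (nsphere n)"
    by (simp add: nsphere_def Hausdorff_space_subtopology Hausdorff_Euclidean_space)
  ultimately have "homeomorphic_map (realization ?K) (nsphere n) f"
    using cont inj compact_polyhedron[OF finite_simplicial_complex_join]
    by (intro continuous_imp_homeomorphic_map) (simp_all add: nsphere_eq_top_of_set)
  then show thesis using that by blast
qed

lemma homology_manifold_join: "compact_triangulated_homology_manifold n (join_complex n \<beta>)"
proof -
  obtain f where "homeomorphic_map (realization (join_complex n \<beta>)) (nsphere n) f"
    by (rule homeomorphic_map_join_nsphere)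
  then show ?thesis
    unfolding compact_triangulated_homology_manifold_def
    using finite_simplicial_complex_join homology_manifold_homeomorphic_map homology_manifold_nsphere by blast
qed

text \<open>A set is determined by its intersections with the disjoint blocks, each of them a proper
  subset of its block. The proper subsets of a block \<open>B\<close> contribute
  \<open>(1 + t) ^ card B - t ^ card B\<close>.\<close>

lemma sum_power_card_avoiding:
  fixes t :: "'a::comm_ring_1"
  assumes "finite J" "\<And>j. j \<in> J \<Longrightarrow> finite (B j)" "pairwise (\<lambda>i j. B i \<inter> B j = {}) J"
  shows "(\<Sum>s | s \<subseteq> (\<Union>j\<in>J. B j) \<and> (\<forall>j\<in>J. \<not> B j \<subseteq> s). t ^ card s) =
    (\<Prod>j\<in>J. (1 + t) ^ card (B j) - t ^ card (B j))"
  using assms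
proof (induction J)
  case (insert j J)
  let ?A = "{s. s \<subseteq> (\<Union>j\<in>J. B j) \<and> (\<forall>j\<in>J. \<not> B j \<subseteq> s)}"
  let ?A' = "{s. s \<subseteq> (\<Union>j\<in>insert j J. B j) \<and> (\<forall>j\<in>insert j J. \<not> B j \<subseteq> s)}"
  have disj: "B j \<inter> B i = {}" if "i \<in> J" for i
    using insert.prems(2) insert.hyps(2) that by (auto simp: pairwise_insert)
  have finB: "finite (B i)" if "i \<in> insert j J" for i using insert.prems(1) that by blast
  have "(\<Sum>s\<in>?A'. t ^ card s) = (\<Sum>(a, s)\<in>{a. a \<subset> B j} \<times> ?A. t ^ card a * t ^ card s)"
  proof (rule sum.reindex_bij_witness[where i = "\<lambda>(a, s). a \<union> s" and j = "\<lambda>s. (s \<inter> B j, s - B j)"])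
    fix s assume s: "s \<in> ?A'"
    show "(case (s \<inter> B j, s - B j) of (a, s) \<Rightarrow> a \<union> s) = s" by auto
    show "(s \<inter> B j, s - B j) \<in> {a. a \<subset> B j} \<times> ?A" using s by auto
    have "finite s" using s insert.hyps(1) finB by (auto intro: finite_subset)
    then have "card s = card (s \<inter> B j) + card (s - B j)"
      by (subst card_Un_disjoint[symmetric]) (auto intro: arg_cong[of _ _ card])
    then show "(case (s \<inter> B j, s - B j) of (a, s) \<Rightarrow> t ^ card a * t ^ card s) = t ^ card s"
      by (simp add: power_add)
  next
    fix p assume "p \<in> {a. a \<subset> B j} \<times> ?A"
    then obtain a s where p: "p = (a, s)" "a \<subset> B j" "s \<in> ?A" by blast
    have sB: "s \<inter> B j = {}" using p(3) disj by blast
    have aB: "a \<inter> B i = {}" if "i \<in> J" for i using p(2) disj[OF that] by blast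
    show "((case p of (a, s) \<Rightarrow> a \<union> s) \<inter> B j, (case p of (a, s) \<Rightarrow> a \<union> s) - B j) = p"
      using p sB by auto
    have "\<not> B j \<subseteq> a \<union> s" using p(2) sB by blast
    moreover have "\<not> B i \<subseteq> a \<union> s" if "i \<in> J" for i
      using p(3) aB[OF that] that by blast
    ultimately show "(case p of (a, s) \<Rightarrow> a \<union> s) \<in> ?A'"
      using p by auto
  qed
  also have "\<dots> = (\<Sum>a | a \<subset> B j. t ^ card a) * (\<Sum>s\<in>?A. t ^ card s)"
    by (simp add: sum_product sum.cartesian_product)
  also have "(\<Sum>a | a \<subset> B j. t ^ card a) = (1 + t) ^ card (B j) - t ^ card (B j)"
  proof -
    have "Pow (B j) = insert (B j) {a. a \<subset> B j}" by auto
    moreover have "finite {a. a \<subset> B j}" using finB by (auto intro: finite_subset[of _ "Pow (B j)"])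
    ultimately show ?thesis using sum_power_card_Pow[of "B j" t] finB
      by (simp add: eq_diff_eq add.commute)
  qed
  also have "(\<Sum>s\<in>?A. t ^ card s) = (\<Prod>j\<in>J. (1 + t) ^ card (B j) - t ^ card (B j))"
    using insert.prems by (intro insert.IH) (auto simp: pairwise_insert)
  finally show ?case using insert.hyps by simp
qed simp

lemma mult_poly_face_poly_join:
  fixes t :: "'a::comm_ring_1"
  shows "t * poly (face_poly (join_complex n \<beta>)) t =
    (\<Prod>j\<in>\<beta> ` {..n}. (1 + t) ^ card (join_block n \<beta> j) - t ^ card (join_block n \<beta> j)) - 1"
proof -
  let ?A = "{s. s \<subseteq> (\<Union>j\<in>\<beta> ` {..n}. join_block n \<beta> j) \<and> (\<forall>j\<in>\<beta> ` {..n}. \<not> join_block n \<beta> j \<subseteq> s)}"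
  \<comment> \<open>The product also counts the empty set, whence the final
    \<open>- 1\<close>.\<close>
  have "?A = insert {} (join_complex n \<beta>)"
    by (auto simp: join_complex_def join_block_def)
  moreover have "{} \<notin> join_complex n \<beta>" by (simp add: join_complex_def)
  ultimately have "(\<Sum>s\<in>?A. t ^ card s) = 1 + (\<Sum>s\<in>join_complex n \<beta>. t ^ card s)"
    using finite_simplicial_complexD(1)[OF finite_simplicial_complex_join[of n \<beta>]] by simp
  moreover have "(\<Sum>s\<in>?A. t ^ card s) =
      (\<Prod>j\<in>\<beta> ` {..n}. (1 + t) ^ card (join_block n \<beta> j) - t ^ card (join_block n \<beta> j))"
  proof (rule sum_power_card_avoiding)
    show "pairwise (\<lambda>i j. join_block n \<beta> i \<inter> join_block n \<beta> j = {}) (\<beta> ` {..n})"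
      by (auto simp: pairwise_def join_block_def)
  qed (simp_all add: finite_join_block)
  ultimately show ?thesis
    unfolding mult_poly_face_poly[OF finite_simplicial_complex_join] by (simp only: eq_diff_eq add.commute)
qed

section \<open>The values of the face polynomial\<close>

text \<open>One coordinate per block: each block is a pair of points and contributes (1 + t)^2 - t^2
  = 1 + 2 t.\<close>

lemma mult_poly_face_poly_cross_polytope:
  "t * poly (face_poly (join_complex n id)) (t :: 'a::comm_ring_1) = (1 + 2 * t) ^ Suc n - 1"
proof -
  have "join_block n id j = {Suc n + j, j}" if "j \<le> n" for j
    using that by (auto simp: join_block_def)
  then have "(1 + t) ^ card (join_block n id j) - t ^ card (join_block n id j) = 1 + 2 * t" if "j \<le> n" for j
    using that by (simp add: power2_eq_square algebra_simps)
  then have "(\<Prod>j\<in>id ` {..n}. (1 + t) ^ card (join_block n id j) - t ^ card (join_block n id j)) =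
      (\<Prod>j\<in>{..n}. 1 + 2 * t)"
    by (intro prod.cong) auto
  then show ?thesis by (simp add: mult_poly_face_poly_join)
qed

text \<open>Truncated subtraction puts the coordinates 0 and 1 into block 0, whose three vertices
  contribute (1 + t)^3 - t^3; all other blocks are pairs.\<close>

lemma mult_poly_face_poly_triangle_join:
  assumes "n \<ge> 1"
  shows "t * poly (face_poly (join_complex n (\<lambda>v. v - 1))) (t :: 'a::comm_ring_1) =
    (1 + 3 * t + 3 * t ^ 2) * (1 + 2 * t) ^ (n - 1) - 1"
proof -
  let ?\<beta> = "\<lambda>v::nat. v - 1"
  have J: "?\<beta> ` {..n} = insert 0 {1..<n}"
  proof (intro antisym subsetI)
    fix j assume "j \<in> insert 0 {1..<n}"
    then show "j \<in> ?\<beta> ` {..n}"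
      using assms by (intro image_eqI[of _ _ "Suc j"]) auto
  qed auto
  have "join_block n ?\<beta> 0 = {Suc n, 0, 1}"
    using assms by (auto simp: join_block_def)
  then have 0: "(1 + t) ^ card (join_block n ?\<beta> 0) - t ^ card (join_block n ?\<beta> 0) = 1 + 3 * t + 3 * t ^ 2"
    using assms by (simp add: eval_nat_numeral algebra_simps)
  have "join_block n ?\<beta> j = {Suc n + j, Suc j}" if "j \<in> {1..<n}" for j
    using that by (auto simp: join_block_def)
  then have "(1 + t) ^ card (join_block n ?\<beta> j) - t ^ card (join_block n ?\<beta> j) = 1 + 2 * t" if "j \<in> {1..<n}" for j
    using that by (simp add: power2_eq_square algebra_simps)
  then have "(\<Prod>j\<in>{1..<n}. (1 + t) ^ card (join_block n ?\<beta> j) - t ^ card (join_block n ?\<beta> j)) =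
      (\<Prod>j\<in>{1..<n}. 1 + 2 * t)"
    by (rule prod.cong[OF refl])
  moreover have "(\<Prod>j\<in>?\<beta> ` {..n}. (1 + t) ^ card (join_block n ?\<beta> j) - t ^ card (join_block n ?\<beta> j)) =
      (1 + 3 * t + 3 * t ^ 2) *
      (\<Prod>j\<in>{1..<n}. (1 + t) ^ card (join_block n ?\<beta> j) - t ^ card (join_block n ?\<beta> j))"
    unfolding J by (subst prod.insert) (simp_all only: 0, simp_all)
  ultimately show ?thesis
    unfolding mult_poly_face_poly_join by simp
qed

text \<open>The factor \<open>t\<close> is cancelled as a polynomial, so that \<open>t = 0\<close> is covered.\<close>

lemma poly_face_poly_difference:
  fixes t :: complex
  assumes "n \<ge> 1"
  shows "poly (face_poly (join_complex n id)) t - poly (face_poly (join_complex n (\<lambda>v. v - 1))) t =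
    (1 + t) * (1 + 2 * t) ^ (n - 1)"
proof -
  \<comment> \<open>The last term comes from (1 + 2 t)^2 - (1 + 3 t + 3 t^2) = t (1 + t).\<close>
  let ?p = "face_poly (join_complex n id) - face_poly (join_complex n (\<lambda>v. v - 1)) - [:1, 1:] * [:1, 2:] ^ (n - 1) :: complex poly"
  have "poly ([:0, 1:] * ?p) s = 0" for s
  proof -
    have n: "(1 + 2 * s) ^ Suc n = (1 + 2 * s) ^ (n - 1) * (1 + 2 * s)\<^sup>2"
      using assms by (cases n) (simp_all add: power2_eq_square)
    have "poly ([:0, 1:] * ?p) s = s * poly (face_poly (join_complex n id)) s
        - s * poly (face_poly (join_complex n (\<lambda>v. v - 1))) s - s * ((1 + s) * (1 + 2 * s) ^ (n - 1))"
      by (simp add: algebra_simps)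
    also have "\<dots> = 0"
      unfolding mult_poly_face_poly_cross_polytope mult_poly_face_poly_triangle_join[OF assms] n
      by (simp add: power2_eq_square algebra_simps)
    finally show ?thesis .
  qed
  then have "[:0, 1:] * ?p = 0"
    using poly_all_0_iff_0 by blast
  then have "?p = 0" by simp
  then have "poly ?p t = 0" by (simp only: poly_0)
  then show ?thesis by (simp add: algebra_simps)
qed

text \<open>In dimension 0 the face polynomial is constant and every \<open>t\<close> qualifies,
  hence the restriction to \<open>n \<ge> 1\<close> in the second part.\<close>

theorem theorem2:
  shows "(\<forall>n (K :: 'v set set).
            even n \<and> compact_triangulated_homology_manifold n K \<longrightarrow>
            of_int (euler_char K) = poly (face_poly K :: real poly) (- 1 / 2))
       \<and> (\<forall>n\<ge>1. \<forall>t :: complex.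
            (\<forall>K :: nat set set. compact_triangulated_homology_manifold n K \<longrightarrow>
                poly (face_poly K) t = of_int (euler_char K))
            \<longleftrightarrow> (if odd n then t = - 1 else t = - 1 \<or> t = - 1 / 2))"
proof (intro conjI allI impI)
  fix n and K :: "'v set set"
  assume "even n \<and> compact_triangulated_homology_manifold n K"
  then show "of_int (euler_char K) = poly (face_poly K :: real poly) (- 1 / 2)"
    using face_poly_minus_half[of n K, where 'a = real] by simp
next
  fix n :: nat and t :: complex
  assume n: "1 \<le> n"
  show "(\<forall>K :: nat set set. compact_triangulated_homology_manifold n K \<longrightarrow>
        poly (face_poly K) t = of_int (euler_char K))
      \<longleftrightarrow> (if odd n then t = - 1 else t = - 1 \<or> t = - 1 / 2)"
  proof
    assume "if odd n then t = - 1 else t = - 1 \<or> t = - 1 / 2"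
    then consider "t = - 1" | "even n" "t = - 1 / 2" by (auto split: if_splits)
    then show "\<forall>K :: nat set set. compact_triangulated_homology_manifold n K \<longrightarrow>
        poly (face_poly K) t = of_int (euler_char K)"
    proof cases
      case 1
      then show ?thesis
        using poly_face_poly_minus_one by (auto simp: compact_triangulated_homology_manifold_def)
    next
      case 2
      then show ?thesis using face_poly_minus_half by blast
    qed
  next
    assume all: "\<forall>K :: nat set set. compact_triangulated_homology_manifold n K \<longrightarrow>
        poly (face_poly K) t = of_int (euler_char K)"
    let ?K = "join_complex n id" and ?L = "join_complex n (\<lambda>v. v - 1)"
    have chi: "of_int (euler_char (join_complex n \<beta>)) = poly (face_poly (join_complex n \<beta>)) (- 1 :: complex)" for \<beta>
      by (rule poly_face_poly_minus_one[OF finite_simplicial_complex_join, symmetric])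
    \<comment> \<open>With chi written as the value at -1, the difference of the two spheres takes
      the same value at \<open>t\<close> as at -1, where it is 0.\<close>
    have t: "poly (face_poly (join_complex n \<beta>)) t = poly (face_poly (join_complex n \<beta>)) (- 1)" for \<beta>
      using all homology_manifold_join chi by metis
    have "(1 + t) * (1 + 2 * t) ^ (n - 1) = 0"
      using poly_face_poly_difference[OF n, of t] poly_face_poly_difference[OF n, of "- 1"] t by simp
    then have "1 + t = 0 \<or> 1 + 2 * t = 0" by auto
    moreover have "t = - 1" if "1 + t = 0" using that by (simp add: add_eq_0_iff)
    moreover have "t = - 1 / 2" if "1 + 2 * t = 0"
      using that by (metis add_eq_0_iff nonzero_mult_div_cancel_left zero_neq_numeral)
    ultimately have "t = - 1 \<or> t = - 1 / 2" by blast
    \<comment> \<open>At -1/2 the factor \<open>1 + 2 * t\<close> vanishes, so the cross-polytope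
      has the value 2 there, whereas its Euler characteristic is 0 in odd dimensions.\<close>
    moreover have "even n" if half: "t = - 1 / 2"
    proof (rule ccontr)
      assume "odd n"
      have "poly (face_poly ?K) t = 2"
        using mult_poly_face_poly_cross_polytope[of t n] by (simp add: half)
      moreover have "poly (face_poly ?K) (- 1 :: complex) = 0"
        using mult_poly_face_poly_cross_polytope[of "- 1 :: complex" n] \<open>odd n\<close> by simp
      ultimately show False using t[of id] by simp
    qed
    ultimately show "if odd n then t = - 1 else t = - 1 \<or> t = - 1 / 2" by auto
  qed
qed

end
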